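(* If $E\subset\mathbb{R}^n$ is cone unrectifiable, then there is a Lipschitz function $f:\mathbb{R}^n\to\mathbb{R}$ that is non-differentiable at every point of $E$.
   Context: $\mathbb{R}^n$ carries the Euclidean norm $\|\cdot\|$ and inner product $\langle\cdot,\cdot\rangle$; $B(x,r)$ is the open ball; $\mathcal{H}^1$ is one-dimensional Hausdorff measure. Width. For $e\in\mathbb{R}^n\setminus\{0\}$ and $\alpha\in(0,1]$ let $C_{e,\alpha}=\{x\in\mathbb{R}^n:\langle x,e\rangle\ge\alpha\|x\|\|e\|\}$ and let $\Gamma_{e,\alpha}$ be the set of Lipschitz curves $\gamma:\mathbb{R}\to\mathbb{R}^n$ such that $\gamma'(t)\in C_{e,\alpha}$ for almost every $t\in\mathbb{R}$. For open $G\subset\mathbb{R}^n$ let $w_{e,\alpha}(G)=\sup\{\mathcal{H}^1(G\cap\gamma(\mathbb{R})):\gamma\in\Gamma_{e,\alpha}\}$, and for arbitrary $E\subset\mathbb{R}^n$ let $w_{e,\alpha}(E)=\inf\{w_{e,\alpha}(G):G\supset E,\ G\text{ open}\}$. When $e=0$ or $\alpha>1$, $w_{e,\alpha}(E)=0$ for every $E\subset\mathbb{R}^n$. For $x\in E\subset\mathbb{R}^n$ let $\mathcal{N}(E,x)=\{e\in\mathbb{R}^n:(\forall\varepsilon>0)(\exists r>0)\ w_{e,\varepsilon}(B(x,r)\cap E)=0\}$. A set $E\subset\mathbb{R}^n$ is cone unrectifiable if $\mathcal{N}(E,x)\neq\{0\}$ for every $x\in E$. *)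

theory Defs
  imports "HOL-Analysis.Analysis"
begin

text \<open>
  One-dimensional Hausdorff (outer) measure, with the normalisation in which a segment has its
  length as measure.  The covers are required to be bounded because \<^const>\<open>diameter\<close> is
  real-valued and carries no information on unbounded sets.  Sequences suffice as countable
  covers, since members may be empty and \<^term>\<open>diameter {} = 0\<close>.
\<close>

definition hausdorff_measure1_pre :: "real \<Rightarrow> 'a::metric_space set \<Rightarrow> ennreal" where
  "hausdorff_measure1_pre \<delta> A =
     (INF C \<in> {C :: nat \<Rightarrow> 'a set. A \<subseteq> (\<Union>i. C i) \<and> (\<forall>i. bounded (C i) \<and> diameter (C i) \<le> \<delta>)}.
        \<Sum>i. ennreal (diameter (C i)))"

definition hausdorff_measure1 :: "'a::metric_space set \<Rightarrow> ennreal" where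
  "hausdorff_measure1 A = (SUP \<delta> \<in> {0<..}. hausdorff_measure1_pre \<delta> A)"

definition dir_cone :: "real ^ 'n \<Rightarrow> real \<Rightarrow> (real ^ 'n) set" where
  "dir_cone e \<alpha> = {x. x \<bullet> e \<ge> \<alpha> * norm x * norm e}"

definition cone_curves :: "real ^ 'n \<Rightarrow> real \<Rightarrow> (real \<Rightarrow> real ^ 'n) set" where
  "cone_curves e \<alpha> =
     {\<gamma>. (\<exists>L. L-lipschitz_on UNIV \<gamma>) \<and>
          (AE t in lebesgue. \<exists>v. (\<gamma> has_vector_derivative v) (at t) \<and> v \<in> dir_cone e \<alpha>)}"

definition width_open :: "real ^ 'n \<Rightarrow> real \<Rightarrow> (real ^ 'n) set \<Rightarrow> ennreal" where
  "width_open e \<alpha> G = (SUP \<gamma> \<in> cone_curves e \<alpha>. hausdorff_measure1 (G \<inter> range \<gamma>))"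

text \<open>
  The width is only meaningful for \<^term>\<open>\<alpha> > 0\<close>.  For open sets the infimum is attained at the
  set itself, by monotonicity of \<^term>\<open>width_open e \<alpha>\<close>, so the two notions agree there
  (when \<^term>\<open>e \<noteq> 0\<close> and \<^term>\<open>\<alpha> \<le> 1\<close>).
\<close>

definition width :: "real ^ 'n \<Rightarrow> real \<Rightarrow> (real ^ 'n) set \<Rightarrow> ennreal" where
  "width e \<alpha> E =
     (if e = 0 \<or> \<alpha> > 1 then 0
      else (INF G \<in> {G. open G \<and> E \<subseteq> G}. width_open e \<alpha> G))"

definition normal_set :: "(real ^ 'n) set \<Rightarrow> real ^ 'n \<Rightarrow> (real ^ 'n) set" where
  "normal_set E x = {e. \<forall>\<epsilon>>0. \<exists>r>0. width e \<epsilon> (ball x r \<inter> E) = 0}"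

definition cone_unrectifiable :: "(real ^ 'n) set \<Rightarrow> bool" where
  "cone_unrectifiable E \<longleftrightarrow> (\<forall>x\<in>E. normal_set E x \<noteq> {0})"

end

(*
  If an open set G contains A and has small width in direction e, then the longest way that a curve
  of the cone can run inside G before reaching x is a small function of x whose gradient on G is
  nearly e.  A difference of two such functions, for G and for a much thinner neighbourhood of A,
  has slope one near A at one scale and slope almost zero on a neighbourhood of A at smaller scales.
  A Lipschitz function that is not differentiable on E is the sum of a sequence of localised
  differences of this kind, each of them supported where all the previous ones have been switched
  off again.  Every step uses a single direction, so the directions of different steps need not be
  related, and at every point at most one summand has a large slope.  The errors of the remaining
  ones are summable because the balls of localisation come from Whitney-type families, in which
  boundedly many balls meet, with the aperture error of the k-th family proportional to 2^(-k).
*)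

theory Submission
  imports Defs
begin

subsection \<open>Pointwise Lipschitz constants\<close>

text \<open>A summand that has been switched off is not flat: both gradients equal \<open>e\<close>
  only up to the aperture, so a residual slope of that order may persist in its ball. Every point of
  \<open>E\<close> must lie in infinitely many balls, because oscillation is needed at arbitrarily
  small scales; hence the residuals have to be summable, which rules out one fixed aperture. The
  radius provided by \<open>normal_set\<close> depends on the aperture as well as on the point, so
  each aperture gets a family of balls of its own. Every summand is bounded by the square of the
  depth of the current neighbourhood of \<open>E\<close>. Where the depth is zero the summand
  therefore has pointwise Lipschitz constant zero, and around a point of depth t all later summands
  are negligible at distances of at least t/2. This isolates two difference quotients in the same
  direction, a large one and a small one, which no linear derivative can accommodate.\<close>

text \<open>The slack \<open>L' > L\<close> allows constant 0 at a point where a function merely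
  vanishes to second order. The bound is attached to a single point since the summands have
  different slopes at different points.\<close>

definition lip_at :: "('a::metric_space \<Rightarrow> real) \<Rightarrow> real \<Rightarrow> 'a \<Rightarrow> bool" where
  "lip_at f L z \<longleftrightarrow> (\<forall>L'>L. \<forall>\<^sub>F y in nhds z. \<bar>f y - f z\<bar> \<le> L' * dist y z)"

lemma lip_at_mono: "lip_at f L z \<Longrightarrow> L \<le> M \<Longrightarrow> lip_at f M z"
  unfolding lip_at_def by auto

lemma lip_atI:
  assumes "\<forall>\<^sub>F y in nhds z. \<bar>f y - f z\<bar> \<le> L * dist y z"
  shows "lip_at f L z"
  unfolding lip_at_def
proof (intro allI impI)
  fix L' assume "L' > L"
  show "\<forall>\<^sub>F y in nhds z. \<bar>f y - f z\<bar> \<le> L' * dist y z"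
    using assms
  proof (rule eventually_mono)
    fix y assume "\<bar>f y - f z\<bar> \<le> L * dist y z"
    also have "\<dots> \<le> L' * dist y z" using \<open>L' > L\<close> by (intro mult_right_mono) auto
    finally show "\<bar>f y - f z\<bar> \<le> L' * dist y z" .
  qed
qed

lemma lip_at_add:
  assumes "lip_at f L z" "lip_at g M z"
  shows "lip_at (\<lambda>x. f x + g x) (L + M) z"
  unfolding lip_at_def
proof (intro allI impI)
  fix K assume K: "K > L + M"
  define r where "r = (K - (L + M)) / 2"
  have r: "r > 0" and Kr: "K = (L + r) + (M + r)" using K by (simp_all add: r_def)
  have "\<forall>\<^sub>F y in nhds z. \<bar>f y - f z\<bar> \<le> (L + r) * dist y z"
    "\<forall>\<^sub>F y in nhds z. \<bar>g y - g z\<bar> \<le> (M + r) * dist y z"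
    using assms r unfolding lip_at_def by auto
  thus "\<forall>\<^sub>F y in nhds z. \<bar>f y + g y - (f z + g z)\<bar> \<le> K * dist y z"
  proof eventually_elim
    case (elim y)
    have "K * dist y z = (L + r) * dist y z + (M + r) * dist y z"
      unfolding Kr by (simp only: distrib_right)
    thus ?case using elim by linarith
  qed
qed

lemma lip_at_uminus: "lip_at f L z \<Longrightarrow> lip_at (\<lambda>x. - f x) L z"
  by (simp add: lip_at_def abs_minus_commute)

lemma lip_at_diff:
  assumes "lip_at f L z" "lip_at g M z"
  shows "lip_at (\<lambda>x. f x - g x) (L + M) z"
  using lip_at_add[OF assms(1) lip_at_uminus[OF assms(2)]] by simp

lemma lip_at_sum:
  assumes "\<And>i. i \<in> I \<Longrightarrow> lip_at (f i) (L i) z"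
  shows "lip_at (\<lambda>x. \<Sum>i\<in>I. f i x) (\<Sum>i\<in>I. L i) z"
  using assms
proof (induction I rule: infinite_finite_induct)
  case (insert i I)
  thus ?case by (simp add: lip_at_add)
qed (auto intro: lip_atI)

text \<open>The variation of the cut-off costs only its Lipschitz constant times the size of
  \<open>k\<close> at the point, so a small \<open>k\<close> is cheap to cut off.\<close>

lemma lip_at_mult:
  assumes k: "lip_at k L z" and "L \<ge> 0" and ph1: "\<And>y. \<bar>\<phi> y\<bar> \<le> 1"
    and phC: "\<And>y. \<bar>\<phi> y - \<phi> z\<bar> \<le> C * dist y z" and "\<bar>k z\<bar> \<le> \<eta>" "C \<ge> 0"
  shows "lip_at (\<lambda>x. \<phi> x * k x) (L + C * \<eta>) z"
  unfolding lip_at_def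
proof (intro allI impI)
  fix K assume K: "K > L + C * \<eta>"
  have "\<forall>\<^sub>F y in nhds z. \<bar>k y - k z\<bar> \<le> (K - C * \<eta>) * dist y z"
    using k K unfolding lip_at_def by auto
  thus "\<forall>\<^sub>F y in nhds z. \<bar>\<phi> y * k y - \<phi> z * k z\<bar> \<le> K * dist y z"
  proof eventually_elim
    case (elim y)
    have "\<bar>\<phi> y * k y - \<phi> z * k z\<bar> = \<bar>\<phi> y * (k y - k z) + (\<phi> y - \<phi> z) * k z\<bar>"
      by (simp add: algebra_simps)
    also have "\<dots> \<le> \<bar>\<phi> y\<bar> * \<bar>k y - k z\<bar> + \<bar>\<phi> y - \<phi> z\<bar> * \<bar>k z\<bar>"
      using abs_triangle_ineq[of "\<phi> y * (k y - k z)" "(\<phi> y - \<phi> z) * k z"] by (simp add: abs_mult)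
    also have "\<dots> \<le> 1 * \<bar>k y - k z\<bar> + (C * dist y z) * \<eta>"
      using ph1[of y] phC[of y] assms by (intro add_mono mult_mono) auto
    also have "\<dots> \<le> (K - C * \<eta>) * dist y z + (C * dist y z) * \<eta>" using elim by simp
    also have "\<dots> = K * dist y z" by (simp add: algebra_simps)
    finally show ?case .
  qed
qed

text \<open>Bisection: the bound with \<open>K > L\<close> is additive over adjacent parameter
  intervals and holds on all short intervals around a given parameter; then \<open>K\<close> tends
  to \<open>L\<close>.\<close>

lemma lip_at_segment:
  fixes x y :: "'a::real_normed_vector"
  assumes "\<And>z. z \<in> closed_segment x y \<Longrightarrow> lip_at f L z"
  shows "\<bar>f y - f x\<bar> \<le> L * dist x y"
proof -
  let ?p = "\<lambda>t::real. x + t *\<^sub>R (y - x)"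
  have dp: "dist (?p s) (?p t) = \<bar>s - t\<bar> * dist x y" for s t
  proof -
    have "?p s - ?p t = (s - t) *\<^sub>R (y - x)" by (simp add: algebra_simps)
    thus ?thesis by (simp add: dist_norm norm_minus_commute)
  qed
  have *: "\<bar>f y - f x\<bar> \<le> K * dist x y" if K: "K > L" for K
  proof -
    have "\<bar>f (?p 1) - f (?p 0)\<bar> \<le> K * (dist x y * (1 - 0))"
    proof (rule Bolzano[of 0 1 "\<lambda>a b. \<bar>f (?p b) - f (?p a)\<bar> \<le> K * (dist x y * (b - a))"])
      fix a b c :: real
      assume "\<bar>f (?p b) - f (?p a)\<bar> \<le> K * (dist x y * (b - a))"
        "\<bar>f (?p c) - f (?p b)\<bar> \<le> K * (dist x y * (c - b))"
      moreover have "K * (dist x y * (c - a)) = K * (dist x y * (b - a)) + K * (dist x y * (c - b))"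
        by (simp add: algebra_simps)
      ultimately show "\<bar>f (?p c) - f (?p a)\<bar> \<le> K * (dist x y * (c - a))" by linarith
    next
      fix t :: real assume t: "0 \<le> t" "t \<le> 1"
      have "?p t \<in> closed_segment x y"
        using t by (auto simp: in_segment algebra_simps intro!: exI[of _ t])
      then have "\<forall>\<^sub>F w in nhds (?p t). \<bar>f w - f (?p t)\<bar> \<le> K * dist w (?p t)"
        using assms K unfolding lip_at_def by blast
      then obtain d where d: "d > 0" "\<And>w. dist w (?p t) < d \<Longrightarrow> \<bar>f w - f (?p t)\<bar> \<le> K * dist w (?p t)"
        by (auto simp: eventually_nhds_metric)
      define e where "e = d / (dist x y + 1)"
      have e: "e > 0" using d by (simp add: e_def add_nonneg_pos)
      have near: "\<bar>f (?p s) - f (?p t)\<bar> \<le> K * (\<bar>s - t\<bar> * dist x y)" if "\<bar>s - t\<bar> < e" for s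
      proof -
        have "\<bar>s - t\<bar> * dist x y \<le> \<bar>s - t\<bar> * (dist x y + 1)" by (simp add: mult_left_mono)
        also have "\<dots> < e * (dist x y + 1)" using that by (intro mult_strict_right_mono) (auto simp: add_nonneg_pos)
        also have "\<dots> = d" using zero_le_dist[of x y] by (simp add: e_def add_nonneg_eq_0_iff)
        finally show ?thesis using d(2)[of "?p s", unfolded dp] by blast
      qed
      show "\<exists>d>0. \<forall>a b. a \<le> t \<and> t \<le> b \<and> b - a < d \<longrightarrow> \<bar>f (?p b) - f (?p a)\<bar> \<le> K * (dist x y * (b - a))"
      proof (intro exI[of _ e] conjI allI impI e)
        fix a b assume ab: "a \<le> t \<and> t \<le> b \<and> b - a < e"
        have "\<bar>f (?p a) - f (?p t)\<bar> \<le> K * ((t - a) * dist x y)"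
          "\<bar>f (?p b) - f (?p t)\<bar> \<le> K * ((b - t) * dist x y)"
          using near[of a] near[of b] ab by auto
        moreover have "K * (dist x y * (b - a)) = K * ((t - a) * dist x y) + K * ((b - t) * dist x y)"
          by (simp add: algebra_simps)
        ultimately show "\<bar>f (?p b) - f (?p a)\<bar> \<le> K * (dist x y * (b - a))" by linarith
      qed
    qed auto
    thus ?thesis by simp
  qed
  show ?thesis
  proof (cases "dist x y = 0")
    case False
    hence pos: "dist x y > 0" by simp
    show ?thesis
    proof (rule field_le_epsilon)
      fix e :: real assume "e > 0"
      show "\<bar>f y - f x\<bar> \<le> L * dist x y + e"
        using *[of "L + e / dist x y"] pos \<open>e > 0\<close> by (simp add: distrib_right)
    qed
  qed auto
qed

lemma lip_at_lipschitz_on: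
  fixes f :: "'a::real_normed_vector \<Rightarrow> real"
  assumes "\<And>z. lip_at f L z" "L \<ge> 0"
  shows "L-lipschitz_on UNIV f"
proof (rule lipschitz_onI)
  fix x y :: 'a
  show "dist (f x) (f y) \<le> L * dist x y"
    using lip_at_segment[of y x f L] assms(1) by (simp add: dist_real_def dist_commute)
qed fact

subsection \<open>Width and functions with prescribed slope\<close>

lemma width_subset:
  assumes "A \<subseteq> B" shows "width e \<alpha> A \<le> width e \<alpha> B"
  using assms unfolding width_def by (auto intro!: INF_superset_mono)

lemma scaleR_dir_cone:
  assumes "c > 0" shows "dir_cone (c *\<^sub>R e) \<alpha> = dir_cone e \<alpha>"
proof -
  have "(x \<bullet> (c *\<^sub>R e) \<ge> \<alpha> * norm x * norm (c *\<^sub>R e)) \<longleftrightarrow> (x \<bullet> e \<ge> \<alpha> * norm x * norm e)" for x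
  proof -
    have "\<alpha> * norm x * norm (c *\<^sub>R e) = c * (\<alpha> * norm x * norm e)" using assms by simp
    moreover have "x \<bullet> (c *\<^sub>R e) = c * (x \<bullet> e)" by simp
    ultimately show ?thesis using assms by (simp only: mult_le_cancel_left_pos)
  qed
  thus ?thesis by (auto simp: dir_cone_def)
qed

lemma scaleR_width:
  assumes "c > 0" shows "width (c *\<^sub>R e) \<alpha> A = width e \<alpha> A"
  using assms by (simp add: width_def width_open_def cone_curves_def scaleR_dir_cone)

section \<open>Cone curves and the length they gain in an open set\<close>

text \<open>Projection to the line of \<open>e\<close> does not increase diameters and sends
  \<open>\<gamma> t\<close> to \<open>t\<close>, so a cover of the trace yields a cover of the
  parameter set by intervals of the same lengths.\<close>

lemma emeasure_le_hausdorff_measure1: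
  fixes \<gamma> :: "real \<Rightarrow> real ^ 'n"
  assumes e: "norm e = 1" and \<gamma>: "\<And>t. \<gamma> t \<bullet> e = t"
  shows "emeasure lborel {t. \<gamma> t \<in> G} \<le> hausdorff_measure1 (G \<inter> range \<gamma>)"
proof -
  let ?T = "{t. \<gamma> t \<in> G}"
  have "emeasure lborel ?T \<le> (\<Sum>i. ennreal (diameter (C i)))"
    if C: "G \<inter> range \<gamma> \<subseteq> (\<Union>i. C i)" and b: "\<And>i. bounded (C i)" for C :: "nat \<Rightarrow> (real ^ 'n) set"
  proof -
    define a where "a i = Inf ((\<lambda>x. x \<bullet> e) ` C i)" for i
    define J where "J i = {a i..a i + diameter (C i)}" for i
    have J: "x \<bullet> e \<in> J i" if x: "x \<in> C i" for x i
    proof -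
      have bd: "bdd_below ((\<lambda>x. x \<bullet> e) ` C i)"
      proof -
        have "bounded ((\<lambda>x. x \<bullet> e) ` C i)"
          by (intro bounded_linear_image b bounded_linear_inner_left)
        thus ?thesis by (rule bounded_imp_bdd_below)
      qed
      have "a i \<le> x \<bullet> e" unfolding a_def using x bd by (intro cInf_lower) auto
      moreover have "x \<bullet> e - diameter (C i) \<le> a i" unfolding a_def
      proof (rule cInf_greatest)
        fix w assume "w \<in> (\<lambda>x. x \<bullet> e) ` C i"
        then obtain y where y: "y \<in> C i" "w = y \<bullet> e" by auto
        have "x \<bullet> e - y \<bullet> e = (x - y) \<bullet> e" by (simp add: inner_diff_left)
        also have "\<dots> \<le> norm (x - y) * norm e" by (rule norm_cauchy_schwarz)
        also have "\<dots> \<le> diameter (C i)"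
          using diameter_bounded_bound[OF b x y(1)] e by (simp add: dist_norm)
        finally show "x \<bullet> e - diameter (C i) \<le> w" using y by simp
      qed (use x in auto)
      ultimately show ?thesis by (simp add: J_def)
    qed
    have "?T \<subseteq> (\<Union>i. J i)"
    proof
      fix t assume "t \<in> ?T"
      then obtain i where "\<gamma> t \<in> C i" using C by auto
      from J[OF this] show "t \<in> (\<Union>i. J i)" using \<gamma> by auto
    qed
    then have "emeasure lborel ?T \<le> emeasure lborel (\<Union>i. J i)"
      by (rule emeasure_mono) (auto simp: J_def)
    also have "\<dots> \<le> (\<Sum>i. emeasure lborel (J i))"
      by (rule emeasure_subadditive_countably) (auto simp: J_def)
    also have "\<dots> = (\<Sum>i. ennreal (diameter (C i)))"
      using b by (auto simp: J_def diameter_ge_0)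
    finally show ?thesis .
  qed
  then have "emeasure lborel ?T \<le> hausdorff_measure1_pre 1 (G \<inter> range \<gamma>)"
    unfolding hausdorff_measure1_pre_def by (intro INF_greatest) auto
  also have "\<dots> \<le> hausdorff_measure1 (G \<inter> range \<gamma>)"
    unfolding hausdorff_measure1_def by (rule SUP_upper) auto
  finally show ?thesis .
qed

text \<open>
  Some cone curve, parametrised by its height over \<open>e\<close>, passes through \<open>x\<close> and has run over a
  length at least \<open>s\<close> inside \<open>G\<close> before.  Finitely many corners suffice, which makes
  almost everywhere differentiability of Lipschitz curves unnecessary.
\<close>

definition ascends :: "real ^ 'n \<Rightarrow> real \<Rightarrow> (real ^ 'n) set \<Rightarrow> real \<Rightarrow> real ^ 'n \<Rightarrow> bool" where
  "ascends e \<alpha> G s x \<longleftrightarrow> (\<exists>\<gamma> S. finite S \<and> (\<exists>L. L-lipschitz_on UNIV \<gamma>) \<and>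
     (\<forall>t. t \<notin> S \<longrightarrow> (\<exists>v. (\<gamma> has_vector_derivative v) (at t) \<and> v \<in> dir_cone e \<alpha>)) \<and>
     (\<forall>t. \<gamma> t \<bullet> e = t) \<and> \<gamma> (x \<bullet> e) = x \<and>
     ennreal s \<le> emeasure lborel {t. t \<le> x \<bullet> e \<and> \<gamma> t \<in> G})"

lemma ascends_0:
  assumes e: "norm e = 1" and "\<alpha> \<le> 1"
  shows "ascends e \<alpha> G 0 x"
proof -
  let ?\<gamma> = "\<lambda>t. x + (t - x \<bullet> e) *\<^sub>R e"
  have ee: "e \<bullet> e = 1" using e by (simp add: norm_eq_1)
  have "1-lipschitz_on UNIV ?\<gamma>"
    by (rule lipschitz_onI) (simp_all add: dist_norm e flip: scaleR_diff_left)
  moreover have "(?\<gamma> has_vector_derivative e) (at t)" for t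
    by (auto intro!: derivative_eq_intros)
  moreover have "e \<in> dir_cone e \<alpha>" using e ee assms by (simp add: dir_cone_def)
  moreover have "?\<gamma> t \<bullet> e = t" for t by (simp add: inner_add_left ee)
  ultimately show ?thesis unfolding ascends_def
    by (intro exI[of _ ?\<gamma>] exI[of _ "{}"]) auto
qed

text \<open>The curve is cut at \<open>x\<close> and continued along a ray. The normalisation
  \<open>w \<bullet> e = 1\<close> keeps height as the parameter, and the cut adds one possible
  corner. The gain \<open>u\<close> counts the new segment only if it is known to stay in
  \<open>G\<close>.\<close>

lemma ascends_extend:
  assumes P: "ascends e \<alpha> G s x" and "s \<ge> 0" and G: "open G" and w: "w \<in> dir_cone e \<alpha>" "w \<bullet> e = 1" and r: "r \<ge> 0"
    and u: "u = 0 \<or> (u = r \<and> (\<forall>t. 0 \<le> t \<and> t \<le> r \<longrightarrow> x + t *\<^sub>R w \<in> G))"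
  shows "ascends e \<alpha> G (s + u) (x + r *\<^sub>R w)"
proof -
  define \<tau> where "\<tau> = x \<bullet> e"
  obtain \<gamma> S L where S: "finite S" and L: "L-lipschitz_on UNIV \<gamma>"
    and der: "\<And>t. t \<notin> S \<Longrightarrow> \<exists>v. (\<gamma> has_vector_derivative v) (at t) \<and> v \<in> dir_cone e \<alpha>"
    and \<gamma>e: "\<And>t. \<gamma> t \<bullet> e = t" and \<gamma>x: "\<gamma> \<tau> = x"
    and meas: "ennreal s \<le> emeasure lborel {t. t \<le> \<tau> \<and> \<gamma> t \<in> G}"
    using P unfolding ascends_def \<tau>_def by blast
  let ?r = "\<lambda>t. x + (t - \<tau>) *\<^sub>R w"
  define \<beta> where "\<beta> t = (if t \<le> \<tau> then \<gamma> t else ?r t)" for t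
  have re: "(x + r *\<^sub>R w) \<bullet> e = \<tau> + r" using w by (simp add: \<tau>_def inner_add_left)
  have L0: "L \<ge> 0" using L by (rule lipschitz_on_nonneg)
  define M where "M = max L (norm w)"
  have \<gamma>M: "dist (\<gamma> a) (\<gamma> b) \<le> M * \<bar>a - b\<bar>" for a b
  proof -
    have "dist (\<gamma> a) (\<gamma> b) \<le> L * dist a b" using L by (rule lipschitz_onD) auto
    also have "\<dots> \<le> M * dist a b" by (intro mult_right_mono) (auto simp: M_def)
    finally show ?thesis by (simp add: dist_real_def)
  qed
  have rM: "dist (?r a) (?r b) \<le> M * \<bar>a - b\<bar>" for a b
  proof -
    have "dist (?r a) (?r b) = \<bar>a - b\<bar> * norm w"
      by (simp add: dist_norm flip: scaleR_diff_left)
    also have "\<dots> \<le> \<bar>a - b\<bar> * M" by (intro mult_left_mono) (auto simp: M_def)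
    finally show ?thesis by (simp add: mult.commute)
  qed
  have mixed: "dist (\<gamma> a) (?r b) \<le> M * \<bar>a - b\<bar>" if "a \<le> \<tau>" "\<tau> < b" for a b
  proof -
    have "dist (\<gamma> a) (?r b) \<le> dist (\<gamma> a) (\<gamma> \<tau>) + dist (?r \<tau>) (?r b)"
      using dist_triangle[of "\<gamma> a" "?r b" x] by (simp add: \<gamma>x)
    also have "\<dots> \<le> M * \<bar>a - \<tau>\<bar> + M * \<bar>\<tau> - b\<bar>" using \<gamma>M rM by (rule add_mono)
    also have "\<dots> = M * \<bar>a - b\<bar>" using that by (simp add: algebra_simps)
    finally show ?thesis .
  qed
  have "M-lipschitz_on UNIV \<beta>"
  proof (rule lipschitz_onI)
    fix a b :: real
    show "dist (\<beta> a) (\<beta> b) \<le> M * dist a b"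
      using \<gamma>M[of a b] rM[of a b] mixed[of a b] mixed[of b a]
      by (auto simp: \<beta>_def dist_real_def dist_commute abs_minus_commute)
  qed (use L0 in \<open>auto simp: M_def\<close>)
  moreover have "\<exists>v. (\<beta> has_vector_derivative v) (at t) \<and> v \<in> dir_cone e \<alpha>"
    if t: "t \<notin> insert \<tau> S" for t
  proof (cases "t < \<tau>")
    case True
    obtain v where v: "(\<gamma> has_vector_derivative v) (at t)" "v \<in> dir_cone e \<alpha>" using der t by auto
    have "(\<beta> has_vector_derivative v) (at t)"
      by (rule has_vector_derivative_transform_within_open[OF v(1), of "{..<\<tau>}"])
         (use True in \<open>auto simp: \<beta>_def\<close>)
    thus ?thesis using v by blast
  next
    case False
    have "(?r has_vector_derivative w) (at t)" by (auto intro!: derivative_eq_intros)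
    hence "(\<beta> has_vector_derivative w) (at t)"
      by (rule has_vector_derivative_transform_within_open[of _ _ _ "{\<tau><..}"])
         (use False t in \<open>auto simp: \<beta>_def\<close>)
    thus ?thesis using w by blast
  qed
  moreover have "\<beta> t \<bullet> e = t" for t
    using \<gamma>e w by (simp add: \<beta>_def inner_add_left \<tau>_def)
  moreover have "\<beta> (\<tau> + r) = x + r *\<^sub>R w"
    using r \<gamma>x by (auto simp: \<beta>_def)
  moreover have "ennreal (s + u) \<le> emeasure lborel {t. t \<le> \<tau> + r \<and> \<beta> t \<in> G}"
  proof -
    have cont: "continuous_on UNIV \<beta>" using \<open>M-lipschitz_on UNIV \<beta>\<close> by (rule lipschitz_on_continuous_on)
    have op: "open {t. \<beta> t \<in> G}" using open_vimage[OF G cont] by (simp add: vimage_def)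
    let ?A = "{t. t \<le> \<tau> \<and> \<gamma> t \<in> G}" and ?B = "{t. t \<le> \<tau> + r \<and> \<beta> t \<in> G}"
    have A: "?A = {..\<tau>} \<inter> {t. \<beta> t \<in> G}" by (auto simp: \<beta>_def)
    have B: "?B = {..\<tau>+r} \<inter> {t. \<beta> t \<in> G}" by auto
    have mA: "?A \<in> sets lborel" and mB: "?B \<in> sets lborel"
      unfolding A B using op by auto
    show ?thesis
    proof (cases "u = 0")
      case True
      have "emeasure lborel ?A \<le> emeasure lborel ?B"
        using mB A B r by (intro emeasure_mono) auto
      thus ?thesis using True meas by simp
    next
      case False
      hence u: "u = r" "\<And>t. 0 \<le> t \<Longrightarrow> t \<le> r \<Longrightarrow> x + t *\<^sub>R w \<in> G" using u by auto
      have sub: "?A \<union> {\<tau><..\<tau>+r} \<subseteq> ?B"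
      proof
        fix t assume t: "t \<in> ?A \<union> {\<tau><..\<tau>+r}"
        show "t \<in> ?B" using t u(2)[of "t - \<tau>"] r by (auto simp: \<beta>_def)
      qed
      have "ennreal (s + u) = ennreal s + ennreal r" using u \<open>s \<ge> 0\<close> r by simp
      also have "\<dots> \<le> emeasure lborel ?A + emeasure lborel {\<tau><..\<tau>+r}"
        using meas r by (intro add_mono) auto
      also have "\<dots> = emeasure lborel (?A \<union> {\<tau><..\<tau>+r})"
        by (rule plus_emeasure) (use mA in auto)
      also have "\<dots> \<le> emeasure lborel ?B" by (rule emeasure_mono[OF sub mB])
      finally show ?thesis .
    qed
  qed
  ultimately show ?thesis unfolding ascends_def re using S
    by (intro exI[of _ \<beta>] exI[of _ "insert \<tau> S"]) auto
qed

lemma ascends_le_width: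
  assumes e: "norm e = 1" and G: "open G" and P: "ascends e \<alpha> G s x"
    and W: "width_open e \<alpha> G \<le> ennreal \<delta>" and "\<delta> \<ge> 0"
  shows "s \<le> \<delta>"
proof -
  obtain \<gamma> S L where S: "finite S" and L: "L-lipschitz_on UNIV \<gamma>"
    and der: "\<And>t. t \<notin> S \<Longrightarrow> \<exists>v. (\<gamma> has_vector_derivative v) (at t) \<and> v \<in> dir_cone e \<alpha>"
    and \<gamma>e: "\<And>t. \<gamma> t \<bullet> e = t"
    and meas: "ennreal s \<le> emeasure lborel {t. t \<le> x \<bullet> e \<and> \<gamma> t \<in> G}"
    using P unfolding ascends_def by blast
  have "AE t in lebesgue. \<exists>v. (\<gamma> has_vector_derivative v) (at t) \<and> v \<in> dir_cone e \<alpha>"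
  proof (rule AE_I')
    show "S \<in> null_sets lebesgue"
      using S by (simp add: negligible_finite flip: negligible_iff_null_sets)
  qed (use der in auto)
  hence \<gamma>: "\<gamma> \<in> cone_curves e \<alpha>" using L by (auto simp: cone_curves_def)
  have "open {t. \<gamma> t \<in> G}"
    using open_vimage[OF G lipschitz_on_continuous_on[OF L]] by (simp add: vimage_def)
  hence "emeasure lborel {t. t \<le> x \<bullet> e \<and> \<gamma> t \<in> G} \<le> emeasure lborel {t. \<gamma> t \<in> G}"
    by (intro emeasure_mono) auto
  also have "\<dots> \<le> hausdorff_measure1 (G \<inter> range \<gamma>)"
    by (rule emeasure_le_hausdorff_measure1[OF e \<gamma>e])
  also have "\<dots> \<le> width_open e \<alpha> G"
    unfolding width_open_def using \<gamma> by (rule SUP_upper)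
  finally have "ennreal s \<le> ennreal \<delta>" using meas W by (meson order_trans)
  thus ?thesis using \<open>\<delta> \<ge> 0\<close> by (simp add: ennreal_le_iff)
qed

text \<open>
  The value at \<open>x\<close> is the largest length in \<open>G\<close> gained by a curve that ends at
  \<open>x + b e\<close>, \<open>b \<ge> 0\<close>, less the overshoot \<open>b\<close>.  The overshoot is what makes the
  function almost constant in the directions orthogonal to \<open>e\<close>.
\<close>

lemma width_function:
  fixes G :: "(real ^ 'n) set"
  assumes e: "norm e = 1" and G: "open G" and \<alpha>: "0 < \<alpha>" "\<alpha> \<le> 1/2"
    and W: "width_open e \<alpha> G \<le> ennreal \<delta>" and \<delta>: "\<delta> \<ge> 0"
  obtains g :: "real ^ 'n \<Rightarrow> real" where
    "\<And>x. 0 \<le> g x" "\<And>x. g x \<le> \<delta>"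
    "\<And>x t. 0 \<le> t \<Longrightarrow> g x \<le> g (x + t *\<^sub>R e)"
    "\<And>x t. 0 \<le> t \<Longrightarrow> g (x + t *\<^sub>R e) \<le> g x + t"
    "\<And>x v. v \<bullet> e = 0 \<Longrightarrow> \<bar>g (x + v) - g x\<bar> \<le> 2 * \<alpha> * norm v"
    "\<And>x t. 0 \<le> t \<Longrightarrow> (\<And>s. 0 \<le> s \<Longrightarrow> s \<le> t \<Longrightarrow> x + s *\<^sub>R e \<in> G) \<Longrightarrow> g (x + t *\<^sub>R e) = g x + t"
proof -
  have ee: "e \<bullet> e = 1" using e by (simp add: norm_eq_1)
  have eC: "e \<in> dir_cone e \<alpha>" using e ee \<alpha> by (simp add: dir_cone_def)
  let ?P = "ascends e \<alpha> G"
  let ?A = "\<lambda>x. {s - b | s b. 0 \<le> b \<and> 0 \<le> s \<and> ?P s (x + b *\<^sub>R e)}"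
  define g where "g x = Sup (?A x)" for x
  have A0: "0 \<in> ?A x" for x
    using ascends_0[OF e, of \<alpha> G x] \<alpha> by (auto intro!: exI[of _ 0])
  have le: "a \<le> \<delta>" if "a \<in> ?A x" for a x
    using that ascends_le_width[OF e G _ W \<delta>] by force
  have bdd: "bdd_above (?A x)" for x using le by (rule bdd_aboveI)
  have up: "s - b \<le> g x" if "0 \<le> b" "0 \<le> s" "?P s (x + b *\<^sub>R e)" for s b x
    unfolding g_def using that bdd by (intro cSup_upper) auto
  have least: "g x \<le> c" if "\<And>s b. 0 \<le> b \<Longrightarrow> 0 \<le> s \<Longrightarrow> ?P s (x + b *\<^sub>R e) \<Longrightarrow> s - b \<le> c" for x c
    unfolding g_def
  proof (rule cSup_least)
    show "?A x \<noteq> {}" using A0[of x] by blast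
  qed (use that in auto)
  have g0: "0 \<le> g x" for x unfolding g_def using A0 bdd by (rule cSup_upper)
  have g\<delta>: "g x \<le> \<delta>" for x
    using ascends_le_width[OF e G _ W \<delta>] by (intro least) fastforce
  have mono: "g x \<le> g (x + t *\<^sub>R e)" if t: "0 \<le> t" for x t
  proof (rule least)
    fix s b assume b: "0 \<le> b" "0 \<le> s" "?P s (x + b *\<^sub>R e)"
    have "?P (s + 0) (x + b *\<^sub>R e + t *\<^sub>R e)"
      by (rule ascends_extend[OF b(3) b(2) G eC ee t]) simp
    hence "?P s ((x + t *\<^sub>R e) + b *\<^sub>R e)" by (simp add: algebra_simps)
    from up[OF b(1,2) this] show "s - b \<le> g (x + t *\<^sub>R e)" .
  qed
  have upper: "g (x + t *\<^sub>R e) \<le> g x + t" if t: "0 \<le> t" for x t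
  proof (rule least)
    fix s b assume b: "0 \<le> b" "0 \<le> s" "?P s (x + t *\<^sub>R e + b *\<^sub>R e)"
    have "?P s (x + (b + t) *\<^sub>R e)" using b(3) by (simp add: algebra_simps)
    from up[OF _ b(2) this] t b(1) show "s - b \<le> g x + t" by simp
  qed
  have perp1: "g (x + v) \<le> g x + 2 * \<alpha> * norm v" if v: "v \<bullet> e = 0" for x v
  proof (cases "v = 0")
    case False
    \<comment> \<open>Climbing by height \<open>T\<close> along \<open>w\<close> undoes the sideways
      step \<open>v\<close>. With this \<open>T\<close> the square of
      \<open>\<alpha> * norm w\<close> is \<open>\<alpha>\<close> squared plus 1/4, so
      \<open>w\<close> lies in the cone.\<close>
    define T where "T = 2 * \<alpha> * norm v"
    have T: "T > 0" using False \<alpha> by (simp add: T_def)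
    define w where "w = e - (1 / T) *\<^sub>R v"
    have we: "w \<bullet> e = 1" using v by (simp add: w_def inner_diff_left ee)
    have "(\<alpha> * norm w)\<^sup>2 \<le> 1"
    proof -
      have "(norm w)\<^sup>2 = 1 + (1 / T)\<^sup>2 * (norm v)\<^sup>2"
        using v unfolding power2_norm_eq_inner w_def
        by (simp add: inner_diff_left inner_diff_right ee inner_commute power2_eq_square)
      also have "(1 / T)\<^sup>2 * (norm v)\<^sup>2 = 1 / (4 * \<alpha>\<^sup>2)"
        using False \<alpha> by (simp add: T_def power2_eq_square divide_simps)
      finally have "(\<alpha> * norm w)\<^sup>2 = \<alpha>\<^sup>2 + 1/4"
        using \<alpha> by (simp add: power_mult_distrib field_simps)
      moreover have "\<alpha>\<^sup>2 \<le> (1/2)\<^sup>2" using \<alpha> by (intro power_mono) auto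
      ultimately show ?thesis by (simp add: power2_eq_square)
    qed
    hence "\<alpha> * norm w \<le> 1" using power2_le_imp_le[of "\<alpha> * norm w" 1] by simp
    hence wC: "w \<in> dir_cone e \<alpha>" using we e by (simp add: dir_cone_def)
    have "g (x + v) \<le> g x + T"
    proof (rule least)
      fix s b assume b: "0 \<le> b" "0 \<le> s" "?P s (x + v + b *\<^sub>R e)"
      have "?P (s + 0) (x + v + b *\<^sub>R e + T *\<^sub>R w)"
        by (rule ascends_extend[OF b(3) b(2) G wC we]) (use T in auto)
      moreover have "x + v + b *\<^sub>R e + T *\<^sub>R w = x + (b + T) *\<^sub>R e"
        using T by (simp add: w_def algebra_simps)
      ultimately have "?P s (x + (b + T) *\<^sub>R e)" by simp
      from up[OF _ b(2) this] T b(1) show "s - b \<le> g x + T" by simp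
    qed
    thus ?thesis by (simp add: T_def)
  qed simp
  have perp: "\<bar>g (x + v) - g x\<bar> \<le> 2 * \<alpha> * norm v" if v: "v \<bullet> e = 0" for x v
    using perp1[OF v, of x] perp1[of "- v" "x + v"] v by simp
  have slope: "g (x + t *\<^sub>R e) = g x + t"
    if t: "0 \<le> t" and inG: "\<And>s. 0 \<le> s \<Longrightarrow> s \<le> t \<Longrightarrow> x + s *\<^sub>R e \<in> G" for x t
  proof -
    have "g x \<le> g (x + t *\<^sub>R e) - t"
    proof (rule least)
      fix s b assume b: "0 \<le> b" "0 \<le> s" "?P s (x + b *\<^sub>R e)"
      show "s - b \<le> g (x + t *\<^sub>R e) - t"
      \<comment> \<open>A curve with overshoot at least \<open>t\<close> serves the higher point
        with less overshoot; a shorter one is prolonged along \<open>e\<close> inside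
        \<open>G\<close> and gains \<open>t - b\<close>.\<close>
      proof (cases "b \<ge> t")
        case True
        have "?P s (x + t *\<^sub>R e + (b - t) *\<^sub>R e)" using b(3) by (simp add: algebra_simps)
        from up[OF _ b(2) this] True show ?thesis by simp
      next
        case False
        have "?P (s + (t - b)) (x + b *\<^sub>R e + (t - b) *\<^sub>R e)"
        proof (rule ascends_extend[OF b(3) b(2) G eC ee])
          have "x + b *\<^sub>R e + u *\<^sub>R e \<in> G" if "0 \<le> u" "u \<le> t - b" for u
            using inG[of "b + u"] that b(1) by (simp add: algebra_simps)
          thus "t - b = 0 \<or> t - b = t - b \<and> (\<forall>u. 0 \<le> u \<and> u \<le> t - b \<longrightarrow> x + b *\<^sub>R e + u *\<^sub>R e \<in> G)"
            by auto
        qed (use False in auto)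
        hence "?P (s + (t - b)) (x + t *\<^sub>R e + 0 *\<^sub>R e)" by (simp add: algebra_simps)
        from up[OF _ _ this] False b(2) show ?thesis by simp
      qed
    qed
    thus ?thesis using upper[OF t, of x] by simp
  qed
  show ?thesis by (rule that[OF g0 g\<delta> mono upper perp slope])
qed

text \<open>The increment is split into its component along \<open>e\<close> and the orthogonal
  rest. A ball inside \<open>G\<close> contains the part of the path that runs along
  \<open>e\<close>, where slope one is needed.\<close>

lemma width_function_local:
  fixes G :: "(real ^ 'n) set"
  assumes e: "norm e = 1" and G: "open G" and \<alpha>: "0 < \<alpha>" "\<alpha> \<le> 1/2"
    and W: "width_open e \<alpha> G \<le> ennreal \<delta>" and \<delta>: "\<delta> \<ge> 0"
  obtains g :: "real ^ 'n \<Rightarrow> real" where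
    "\<And>x. 0 \<le> g x" "\<And>x. g x \<le> \<delta>"
    "\<And>x y. \<bar>g y - g x\<bar> \<le> (1 + 2 * \<alpha>) * dist y x"
    "\<And>x y r. ball x r \<subseteq> G \<Longrightarrow> dist y x < r \<Longrightarrow> \<bar>g y - g x - (y - x) \<bullet> e\<bar> \<le> 2 * \<alpha> * dist y x"
proof -
  have ee: "e \<bullet> e = 1" using e by (simp add: norm_eq_1)
  obtain g :: "real ^ 'n \<Rightarrow> real" where g: "\<And>x. 0 \<le> g x" "\<And>x. g x \<le> \<delta>"
    and mono: "\<And>x t. 0 \<le> t \<Longrightarrow> g x \<le> g (x + t *\<^sub>R e)"
    and upper: "\<And>x t. 0 \<le> t \<Longrightarrow> g (x + t *\<^sub>R e) \<le> g x + t"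
    and perp: "\<And>x v. v \<bullet> e = 0 \<Longrightarrow> \<bar>g (x + v) - g x\<bar> \<le> 2 * \<alpha> * norm v"
    and slope: "\<And>x t. 0 \<le> t \<Longrightarrow> (\<And>s. 0 \<le> s \<Longrightarrow> s \<le> t \<Longrightarrow> x + s *\<^sub>R e \<in> G) \<Longrightarrow> g (x + t *\<^sub>R e) = g x + t"
    using width_function[OF assms] by metis
  have split: "\<exists>v. v \<bullet> e = 0 \<and> y = x + ((y - x) \<bullet> e) *\<^sub>R e + v \<and> norm v \<le> dist y x" for x y
  proof (intro exI[of _ "y - x - ((y - x) \<bullet> e) *\<^sub>R e"] conjI)
    let ?u = "y - x" let ?v = "?u - (?u \<bullet> e) *\<^sub>R e"
    show v0: "?v \<bullet> e = 0" by (simp add: inner_diff_left ee)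
    have "(norm ?v)\<^sup>2 \<le> (norm ?u)\<^sup>2"
      unfolding power2_norm_eq_inner
      by (simp add: inner_diff_left inner_diff_right inner_commute ee power2_eq_square)
    thus "norm ?v \<le> dist y x" unfolding dist_norm by (rule power2_le_imp_le) simp
  qed simp
  have tb: "\<bar>(y - x) \<bullet> e\<bar> \<le> dist y x" for x y
    using Cauchy_Schwarz_ineq2[of "y - x" e] e by (simp add: dist_norm)
  show ?thesis
  proof (rule that[OF g])
    fix x y
    define t where "t = (y - x) \<bullet> e"
    obtain v where v: "v \<bullet> e = 0" "y = x + t *\<^sub>R e + v" "norm v \<le> dist y x"
      using split[of y x] unfolding t_def by blast
    have 1: "\<bar>g y - g (x + t *\<^sub>R e)\<bar> \<le> 2 * \<alpha> * dist y x"
    proof -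
      have "2 * \<alpha> * norm v \<le> 2 * \<alpha> * dist y x" using v(3) \<alpha> by (intro mult_left_mono) auto
      thus ?thesis using perp[OF v(1), of "x + t *\<^sub>R e"] unfolding v(2)[symmetric] by linarith
    qed
    have "\<bar>g (x + t *\<^sub>R e) - g x\<bar> \<le> \<bar>t\<bar>"
    proof (cases "t \<ge> 0")
      case True
      thus ?thesis using mono[of t x] upper[of t x] by simp
    next
      case False
      thus ?thesis using mono[of "-t" "x + t *\<^sub>R e"] upper[of "-t" "x + t *\<^sub>R e"] by simp
    qed
    thus "\<bar>g y - g x\<bar> \<le> (1 + 2 * \<alpha>) * dist y x"
      using 1 tb[of y x] by (simp add: t_def algebra_simps)
    fix r assume r: "ball x r \<subseteq> G" "dist y x < r"
    have inG: "x + s *\<^sub>R e \<in> G" if "\<bar>s\<bar> \<le> \<bar>t\<bar>" for s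
    proof -
      have "dist x (x + s *\<^sub>R e) < r" using that tb[of y x] r(2) e by (simp add: t_def dist_norm)
      thus ?thesis using r(1) by auto
    qed
    have "g (x + t *\<^sub>R e) = g x + t"
    proof (cases "t \<ge> 0")
      case True
      thus ?thesis using inG by (intro slope) auto
    next
      case False
      have "g ((x + t *\<^sub>R e) + (-t) *\<^sub>R e) = g (x + t *\<^sub>R e) + (-t)"
      proof (rule slope)
        fix s assume s: "0 \<le> s" "s \<le> - t"
        have "x + (t + s) *\<^sub>R e \<in> G" using s False by (intro inG) auto
        thus "x + t *\<^sub>R e + s *\<^sub>R e \<in> G" by (simp add: algebra_simps)
      qed (use False in auto)
      thus ?thesis by simp
    qed
    thus "\<bar>g y - g x - (y - x) \<bullet> e\<bar> \<le> 2 * \<alpha> * dist y x" using 1 by (simp add: t_def)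
  qed
qed

text \<open>
  An open set \<open>U\<close> is encoded by a depth function with \<open>U = {x. 0 < d x}\<close>; unlike the distance to
  the complement, this causes no exception for \<open>U = UNIV\<close>.
\<close>

definition depth :: "('a::metric_space \<Rightarrow> real) \<Rightarrow> bool" where
  "depth d \<longleftrightarrow> (\<forall>x. 0 \<le> d x \<and> d x \<le> 1) \<and> (\<forall>x y. \<bar>d x - d y\<bar> \<le> dist x y)"

lemma depthD:
  assumes "depth d"
  shows "0 \<le> d x" "d x \<le> 1" "\<bar>d x - d y\<bar> \<le> dist x y"
  using assms by (auto simp: depth_def)

lemma depth_continuous:
  fixes d :: "'a::metric_space \<Rightarrow> real"
  assumes "depth d" shows "continuous_on UNIV d"
proof -
  have "1-lipschitz_on UNIV d"
    using assms by (intro lipschitz_onI) (auto simp: depth_def dist_real_def)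
  thus ?thesis by (rule lipschitz_on_continuous_on)
qed

lemma open_depth_greater:
  fixes d :: "'a::metric_space \<Rightarrow> real"
  assumes "depth d" shows "open {x. c < d x}"
  by (intro open_Collect_less depth_continuous assms continuous_on_const)

lemma depth_of_open:
  fixes U :: "'a::metric_space set"
  assumes "open U" "depth d"
  obtains d' where "depth d'" "\<And>x. d' x \<le> d x" "\<And>x. 0 < d' x \<longleftrightarrow> x \<in> U \<and> 0 < d x"
proof (cases "U = UNIV")
  case False
  let ?i = "\<lambda>x. infdist x (- U)"
  have i: "\<bar>?i x - ?i y\<bar> \<le> dist x y" for x y
    using infdist_triangle[of x "- U" y] infdist_triangle[of y "- U" x] by (simp add: dist_commute)
  have pos: "0 < ?i x \<longleftrightarrow> x \<in> U" for x
  proof -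
    have "?i x = 0 \<longleftrightarrow> x \<in> - U"
      using in_closed_iff_infdist_zero[of "- U" x] assms(1) False by auto
    thus ?thesis using infdist_nonneg[of x "- U"] by force
  qed
  have "depth (\<lambda>x. min (d x) (?i x))"
    unfolding depth_def
  proof (intro conjI allI)
    fix x y
    show "0 \<le> min (d x) (?i x)" "min (d x) (?i x) \<le> 1"
      using depthD[OF assms(2), of x] infdist_nonneg[of x "- U"] by auto
    show "\<bar>min (d x) (?i x) - min (d y) (?i y)\<bar> \<le> dist x y"
      using depthD(3)[OF assms(2), of x y] i[of x y] by linarith
  qed
  thus ?thesis using pos by (intro that[of "\<lambda>x. min (d x) (?i x)"]) auto
qed (use assms that[of d] in auto)

lemma width_zero_open:
  assumes "width e \<alpha> A = 0" "e \<noteq> 0" "\<alpha> \<le> 1" "\<delta> > 0"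
  obtains G where "open G" "A \<subseteq> G" "width_open e \<alpha> G \<le> ennreal \<delta>"
proof -
  have "(INF G \<in> {G. open G \<and> A \<subseteq> G}. width_open e \<alpha> G) < ennreal \<delta>"
    using assms by (simp add: width_def)
  then obtain G where "open G" "A \<subseteq> G" "width_open e \<alpha> G < ennreal \<delta>"
    by (auto simp: INF_less_iff)
  thus ?thesis using that by auto
qed

text \<open>
  The function is the infimum of \<open>k i + \<epsilon> max(0, d - 2 powr - i)\<close>, where \<open>k i\<close> is the
  function of an open \<open>G i \<supseteq> A\<close> of width below a multiple of \<open>4 powr - i\<close>.  The penalty excludes
  large \<open>i\<close> where \<open>d\<close> is large, so the infimum is locally over finitely many \<open>i\<close>, while
  where \<open>d\<close> is small the infimum is dominated by a tiny \<open>k i\<close>.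
\<close>

lemma slope_function:
  fixes A :: "(real ^ 'n) set" and d :: "real ^ 'n \<Rightarrow> real"
  assumes e: "norm e = 1" and \<epsilon>: "0 < \<epsilon>" "\<epsilon> \<le> 1/4" and W: "width e \<epsilon> A = 0"
    and d: "depth d" and Ad: "\<And>x. x \<in> A \<Longrightarrow> 0 < d x" and \<eta>: "0 < \<eta>"
  obtains g d' :: "real ^ 'n \<Rightarrow> real" where
    "\<And>x. 0 \<le> g x" "\<And>x. g x \<le> \<eta> * (d x)\<^sup>2" "\<And>x y. \<bar>g y - g x\<bar> \<le> 2 * dist y x"
    "depth d'" "\<And>x. d' x \<le> d x" "\<And>x. x \<in> A \<Longrightarrow> 0 < d' x"
    "\<And>z. 0 < d' z \<Longrightarrow> lip_at (\<lambda>x. g x - x \<bullet> e) (3 * \<epsilon>) z"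
proof -
  \<comment> \<open>The bound \<open>\<epsilon> / 4\<close> makes \<open>g x\<close> at most
    \<open>\<epsilon> * d x / 4\<close>, well below the penalty \<open>\<epsilon> * d x / 2\<close>
    of an index that is too large.\<close>
  define \<theta> where "\<theta> = min \<eta> (\<epsilon> / 4)"
  have \<theta>: "0 < \<theta>" "\<theta> \<le> \<eta>" "\<theta> \<le> \<epsilon> / 4" using \<epsilon> \<eta> by (auto simp: \<theta>_def)
  \<comment> \<open>This is \<open>\<theta>\<close> times the square of
    \<open>(1/2) ^ Suc i\<close>. The index with \<open>(1/2) ^ Suc i < d x \<le> (1/2) ^ i\<close>
    pays no penalty, which yields the quadratic bound.\<close>
  define \<delta> where "\<delta> i = \<theta> * (1/4) ^ Suc i" for i
  have \<delta>: "\<delta> i > 0" for i using \<theta> by (simp add: \<delta>_def)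
  have "\<exists>G. open G \<and> A \<subseteq> G \<and> width_open e \<epsilon> G \<le> ennreal (\<delta> i)" for i
  proof -
    have "e \<noteq> 0" "\<epsilon> \<le> 1" using e \<epsilon> by auto
    thus ?thesis using width_zero_open[OF W _ _ \<delta>[of i]] by metis
  qed
  then obtain G where G: "\<And>i. open (G i)" "\<And>i. A \<subseteq> G i" "\<And>i. width_open e \<epsilon> (G i) \<le> ennreal (\<delta> i)"
    by metis
  have "\<exists>g. (\<forall>x. 0 \<le> g x) \<and> (\<forall>x. g x \<le> \<delta> i) \<and>
    (\<forall>x y. \<bar>g y - g x\<bar> \<le> (1 + 2 * \<epsilon>) * dist y x) \<and>
    (\<forall>x y r. ball x r \<subseteq> G i \<longrightarrow> dist y x < r \<longrightarrow> \<bar>g y - g x - (y - x) \<bullet> e\<bar> \<le> 2 * \<epsilon> * dist y x)" for i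
  proof -
    have "\<epsilon> \<le> 1/2" using \<epsilon> by simp
    then show ?thesis
      by (rule width_function_local[OF e G(1)[of i] \<epsilon>(1) _ G(3)[of i] less_imp_le[OF \<delta>[of i]]]) blast
  qed
  then obtain k where k: "\<And>i x. 0 \<le> k i x" "\<And>i x. k i x \<le> \<delta> i"
    "\<And>i x y. \<bar>k i y - k i x\<bar> \<le> (1 + 2 * \<epsilon>) * dist y x"
    "\<And>i x y r. ball x r \<subseteq> G i \<Longrightarrow> dist y x < r \<Longrightarrow> \<bar>k i y - k i x - (y - x) \<bullet> e\<bar> \<le> 2 * \<epsilon> * dist y x"
    by metis
  define m where "m i x = k i x + \<epsilon> * max 0 (d x - (1/2) ^ i)" for i x
  define g where "g x = (INF i. m i x)" for x
  have m0: "0 \<le> m i x" for i x using k(1) \<epsilon> by (simp add: m_def)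
  have bdd: "bdd_below (range (\<lambda>i. m i x))" for x using m0 by (intro bdd_belowI[of _ 0]) auto
  have glow: "g x \<le> m i x" for i x unfolding g_def using bdd by (intro cINF_lower) auto
  have gex: "\<exists>i. m i x < c" if "g x < c" for x c
    using that bdd[of x] unfolding g_def by (subst (asm) cINF_less_iff) auto
  have g0: "0 \<le> g x" for x unfolding g_def using m0 by (intro cINF_greatest) auto
  have g\<theta>: "g x \<le> \<theta> * (d x)\<^sup>2" for x
  proof (cases "d x = 0")
    case True
    have "g x \<le> 0"
    proof (rule ccontr)
      assume "\<not> g x \<le> 0"
      hence "0 < g x / \<theta>" using \<theta> by simp
      then obtain i where i: "(1/4) ^ i < g x / \<theta>"
        using real_arch_pow_inv[of "g x / \<theta>" "1/4"] by auto
      have "m i x \<le> \<delta> i" using k(2)[of i x] True by (simp add: m_def)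
      also have "\<dots> \<le> \<theta> * (1/4)^i" using \<theta> by (simp add: \<delta>_def)
      also have "\<dots> < g x" using i \<theta> by (simp add: field_simps)
      finally show False using glow[of x i] by simp
    qed
    thus ?thesis using True by simp
  next
    case False
    hence dx: "0 < d x" "d x \<le> 1" using depthD[OF d, of x] by auto
    define i where "i = (LEAST i. (1/2) ^ Suc i < d x)"
    obtain j where "(1/2) ^ j < d x" using real_arch_pow_inv[of "d x" "1/2"] dx by auto
    hence "(1/2) ^ Suc j < d x" using dx by simp
    hence i1: "(1/2) ^ Suc i < d x" unfolding i_def by (rule LeastI)
    have i2: "d x \<le> (1/2) ^ i"
    proof (cases i)
      case (Suc i')
      hence "i' < i" by simp
      hence "\<not> (1/2) ^ Suc i' < d x" unfolding i_def by (rule not_less_Least)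
      thus ?thesis using Suc by simp
    qed (use dx in simp)
    have "m i x \<le> \<delta> i" using k(2)[of i x] i2 by (simp add: m_def)
    also have "\<delta> i = \<theta> * ((1/2) ^ Suc i)\<^sup>2"
      by (simp add: \<delta>_def power2_eq_square flip: power_mult_distrib)
    also have "\<dots> \<le> \<theta> * (d x)\<^sup>2"
      using i1 \<theta> by (intro mult_left_mono power_mono) auto
    finally show ?thesis using glow[of x i] by simp
  qed
  have dmax: "\<bar>max 0 (d y - c) - max 0 (d x - c)\<bar> \<le> dist y x" for x y c
    using depthD(3)[OF d, of y x] by linarith
  have mb: "\<bar>\<epsilon> * max 0 (d y - c) - \<epsilon> * max 0 (d x - c)\<bar> \<le> \<epsilon> * dist y x" for x y c
    using mult_left_mono[OF dmax[of y c x], of \<epsilon>] \<epsilon> by (simp add: abs_mult flip: right_diff_distrib)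
  have mlip: "m i y \<le> m i x + 2 * dist y x" for i x y
  proof -
    have "m i y - m i x \<le> (1 + 2 * \<epsilon>) * dist y x + \<epsilon> * dist y x"
      using k(3)[of i y x] mb[of y "(1/2)^i" x] unfolding m_def by linarith
    also have "\<dots> = (1 + 3 * \<epsilon>) * dist y x" by (simp add: algebra_simps)
    also have "\<dots> \<le> 2 * dist y x" using \<epsilon> by (intro mult_right_mono) auto
    finally show ?thesis by simp
  qed
  have glip1: "g y \<le> g x + 2 * dist y x" for x y
  proof (rule field_le_epsilon)
    fix c :: real assume "c > 0"
    then obtain i where "m i x < g x + c" using gex[of x "g x + c"] by auto
    thus "g y \<le> g x + 2 * dist y x + c" using mlip[of i y x] glow[of y i] by simp
  qed
  have glip: "\<bar>g y - g x\<bar> \<le> 2 * dist y x" for x y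
    using glip1[of y x] glip1[of x y] by (simp add: dist_commute)
  \<comment> \<open>All competing indices need slope one at once. Finitely many \<open>G i\<close>
    have an open intersection, and each contains \<open>A\<close>, so the sets \<open>U n\<close>
    together cover \<open>A\<close>.\<close>
  define U where "U n = {x. (1/2) ^ n < d x} \<inter> (\<Inter>i\<in>{..n}. G i)" for n
  have oU: "open (U n)" for n
    unfolding U_def by (intro open_Int open_depth_greater[OF d] open_INT) (auto simp: G)
  \<comment> \<open>On \<open>U n\<close> only the indices up to \<open>n\<close> compete for the infimum.\<close>
  have inactive: "n \<ge> i" if x: "x \<in> U n" and i: "m i x < g x + \<epsilon> * d x / 4" for n i x
  proof (rule ccontr)
    assume "\<not> n \<ge> i"
    hence "(1/2::real) ^ i \<le> (1/2) ^ Suc n" by (intro power_decreasing) auto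
    also have "\<dots> < d x / 2" using x by (simp add: U_def)
    finally have "d x / 2 \<le> max 0 (d x - (1/2) ^ i)" by linarith
    hence "\<epsilon> * (d x / 2) \<le> \<epsilon> * max 0 (d x - (1/2) ^ i)"
      using \<epsilon> by (intro mult_left_mono) auto
    hence "\<epsilon> * d x / 2 \<le> m i x" using k(1)[of i x] by (simp add: m_def)
    moreover have "g x \<le> \<epsilon> * d x / 4"
    proof -
      have "(d x)\<^sup>2 \<le> d x"
        using depthD[OF d, of x] by (simp add: power2_eq_square mult_left_le_one_le)
      hence "\<theta> * (d x)\<^sup>2 \<le> (\<epsilon> / 4) * d x"
        using \<theta> depthD[OF d, of x] by (intro mult_mono) auto
      thus ?thesis using g\<theta>[of x] by simp
    qed
    ultimately show False using i by simp
  qed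
  have local: "lip_at (\<lambda>x. g x - x \<bullet> e) (3 * \<epsilon>) z" if z: "z \<in> U n" for n z
  proof -
    obtain r where r: "r > 0" "ball z r \<subseteq> U n" using oU z open_contains_ball by blast
    have mi: "\<bar>m i y - m i z - (y - z) \<bullet> e\<bar> \<le> 3 * \<epsilon> * dist y z" if "i \<le> n" "dist y z < r" for i y
    proof -
      have "ball z r \<subseteq> G i" using r that by (auto simp: U_def)
      from k(4)[OF this that(2)] mb[of y "(1/2)^i" z] show ?thesis by (simp add: m_def)
    qed
    have "\<bar>(g y - y \<bullet> e) - (g z - z \<bullet> e)\<bar> \<le> 3 * \<epsilon> * dist y z" if y: "dist y z < r" for y
    proof -
      have yU: "y \<in> U n" using r y by (auto simp: dist_commute)
      have active: "\<exists>i\<le>n. m i x < g x + c" if x: "x \<in> U n" and c: "c > 0" for x c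
      proof -
        have "0 < (1/2::real) ^ n" by simp
        also have "\<dots> < d x" using x by (simp add: U_def)
        finally have "0 < d x" .
        hence "g x < g x + min c (\<epsilon> * d x / 4)" using c \<epsilon> by simp
        from gex[OF this] obtain i where "m i x < g x + min c (\<epsilon> * d x / 4)" by blast
        thus ?thesis using inactive[OF x, of i] by (intro exI[of _ i]) auto
      qed
      have "g y \<le> g z + (y - z) \<bullet> e + 3 * \<epsilon> * dist y z"
      proof (rule field_le_epsilon)
        fix c :: real assume "c > 0"
        then obtain i where "i \<le> n" "m i z < g z + c" using active[OF z] by blast
        thus "g y \<le> g z + (y - z) \<bullet> e + 3 * \<epsilon> * dist y z + c"
          using mi[of i y] y glow[of y i] by linarith
      qed
      moreover have "g z \<le> g y - (y - z) \<bullet> e + 3 * \<epsilon> * dist y z"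
      proof (rule field_le_epsilon)
        fix c :: real assume "c > 0"
        then obtain i where "i \<le> n" "m i y < g y + c" using active[OF yU] by blast
        thus "g z \<le> g y - (y - z) \<bullet> e + 3 * \<epsilon> * dist y z + c"
          using mi[of i y] y glow[of z i] by linarith
      qed
      ultimately show ?thesis by (simp add: inner_diff_left abs_le_iff)
    qed
    thus ?thesis using r(1) by (intro lip_atI) (auto simp: eventually_nhds_metric)
  qed
  obtain d' where d': "depth d'" "\<And>x. d' x \<le> d x" "\<And>x. 0 < d' x \<longleftrightarrow> x \<in> (\<Union>n. U n) \<and> 0 < d x"
    using depth_of_open[of "\<Union>n. U n" d] oU d by (metis open_UN)
  show ?thesis
  proof (rule that[OF g0 _ glip d'(1,2)])
    fix x
    show "g x \<le> \<eta> * (d x)\<^sup>2"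
      using g\<theta>[of x] mult_right_mono[OF \<theta>(2), of "(d x)\<^sup>2"] by simp
    show "0 < d' x" if x: "x \<in> A"
    proof -
      obtain n where "(1/2) ^ n < d x" using real_arch_pow_inv[of "d x" "1/2"] Ad[OF x] by auto
      hence "x \<in> U n" using x G(2) by (auto simp: U_def)
      thus ?thesis using d'(3) Ad[OF x] by auto
    qed
    show "lip_at (\<lambda>x. g x - x \<bullet> e) (3 * \<epsilon>) x" if "0 < d' x"
      using that local d'(3) by auto
  qed
qed

subsection \<open>Switching a slope on and off\<close>

lemma lip_at_of_lipschitz:
  assumes "\<And>y. \<bar>f y - f z\<bar> \<le> L * dist y z" shows "lip_at f L z"
  using assms by (intro lip_atI always_eventually) auto

lemma bump_function:
  fixes c :: "'a::metric_space"
  assumes r: "r > 0"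
  obtains \<phi> :: "'a \<Rightarrow> real" where "\<And>x. \<bar>\<phi> x\<bar> \<le> 1" "\<And>x y. \<bar>\<phi> y - \<phi> x\<bar> \<le> 4 / r * dist y x"
    "\<And>x. dist c x \<le> 3 / 4 * r \<Longrightarrow> \<phi> x = 1" "\<And>x. x \<notin> cball c r \<Longrightarrow> \<phi> x = 0"
proof
  let ?f = "\<lambda>x. 4 / r * (r - dist c x)"
  let ?\<phi> = "\<lambda>x. max 0 (min 1 (?f x))"
  show "\<bar>?\<phi> x\<bar> \<le> 1" for x by auto
  show "\<bar>?\<phi> y - ?\<phi> x\<bar> \<le> 4 / r * dist y x" for x y
  proof -
    have "\<bar>dist c x - dist c y\<bar> \<le> dist y x"
      using dist_triangle[of c x y] dist_triangle[of c y x] by (simp add: dist_commute)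
    hence "4 / r * \<bar>dist c x - dist c y\<bar> \<le> 4 / r * dist y x"
      using r by (intro mult_left_mono) auto
    moreover have "?f y - ?f x = 4 / r * (dist c x - dist c y)"
      unfolding right_diff_distrib[symmetric] by simp
    hence "\<bar>?f y - ?f x\<bar> = 4 / r * \<bar>dist c x - dist c y\<bar>" using r by (simp only: abs_mult) simp
    ultimately show ?thesis by linarith
  qed
  show "?\<phi> x = 1" if "dist c x \<le> 3 / 4 * r" for x
  proof -
    have "1 \<le> ?f x" using that r by (simp add: field_simps)
    thus ?thesis by simp
  qed
  show "?\<phi> x = 0" if "x \<notin> cball c r" for x
  proof -
    have "?f x \<le> 0" using that r by (intro mult_nonneg_nonpos) auto
    thus ?thesis by simp
  qed
qed

text \<open>
  \<open>h\<close> is a cut-off of \<open>g - g'\<close>: near \<open>E\<close> the function \<open>g\<close> adds slope one in direction \<open>e\<close>,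
  and the much smaller \<open>g'\<close>, which lives on a smaller neighbourhood, removes it again.
\<close>

lemma toggle_step:
  fixes E :: "(real ^ 'n) set" and d :: "real ^ 'n \<Rightarrow> real"
  assumes e: "norm e = 1" and \<epsilon>: "0 < \<epsilon>" "\<epsilon> \<le> 1/16" and W: "width e \<epsilon> (E \<inter> ball c (2 * r)) = 0"
    and r: "r > 0" and d: "depth d" and Ed: "\<And>x. x \<in> E \<Longrightarrow> 0 < d x" and \<kappa>: "\<kappa> > 0"
  obtains h d' :: "real ^ 'n \<Rightarrow> real" where
    "\<And>x. \<bar>h x\<bar> \<le> \<kappa> * (d x)\<^sup>2" "\<And>z. lip_at h 5 z"
    "depth d'" "\<And>x. d' x \<le> d x" "\<And>x. x \<in> E \<Longrightarrow> 0 < d' x"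
    "\<And>z. 0 < d' z \<Longrightarrow> z \<in> cball c r \<Longrightarrow> lip_at h (20 * \<epsilon>) z"
    "\<And>z. z \<notin> cball c r \<Longrightarrow> lip_at h 0 z"
    "\<And>x. x \<in> E \<Longrightarrow> x \<in> ball c (r / 2) \<Longrightarrow> \<exists>y. 0 < dist y x \<and> dist y x \<le> \<kappa> \<and>
       (\<forall>z\<in>closed_segment x y. 0 < d z) \<and> dist y x / 2 \<le> \<bar>h y - h x\<bar>"
proof -
  define A where "A = E \<inter> ball c (2 * r)"
  \<comment> \<open>\<open>\<tau>\<close> scales the test step from \<open>x\<close> to
    \<open>y\<close>: \<open>r / 4\<close> keeps \<open>y\<close> where the cut-off equals 1, and
    \<open>\<kappa>\<close> bounds the length of the step.\<close>
  define \<tau> where "\<tau> = min (1/2) (min (r / 4) \<kappa>)"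
  have \<tau>: "0 < \<tau>" "\<tau> \<le> 1/2" "\<tau> \<le> r / 4" "\<tau> \<le> \<kappa>" using r \<kappa> by (auto simp: \<tau>_def)
  \<comment> \<open>In turn: the required size of \<open>h\<close>, a cut-off error
    \<open>4 / r * \<eta>\<close> of at most \<open>\<epsilon>\<close>, and a value of
    \<open>g'\<close> at \<open>y\<close> of at most an eighth of the step.\<close>
  define \<eta> where "\<eta> = min \<kappa> (min (\<epsilon> * r / 4) (\<tau> / 40))"
  have \<eta>: "0 < \<eta>" "\<eta> \<le> \<kappa>" "\<eta> \<le> \<epsilon> * r / 4" "\<eta> \<le> \<tau> / 40" using r \<kappa> \<epsilon> \<tau> by (auto simp: \<eta>_def)
  have \<epsilon>4: "\<epsilon> \<le> 1/4" using \<epsilon> by simp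
  have WA: "width e \<epsilon> A = 0" using W by (simp add: A_def)
  have A: "x \<in> E" if "x \<in> A" for x using that by (simp add: A_def)
  obtain g d1 where g: "\<And>x. 0 \<le> g x" "\<And>x. g x \<le> \<eta> * (d x)\<^sup>2" "\<And>x y. \<bar>g y - g x\<bar> \<le> 2 * dist y x"
    and d1: "depth d1" "\<And>x. d1 x \<le> d x" "\<And>x. x \<in> A \<Longrightarrow> 0 < d1 x"
    and g_slope: "\<And>z. 0 < d1 z \<Longrightarrow> lip_at (\<lambda>x. g x - x \<bullet> e) (3 * \<epsilon>) z"
    using slope_function[OF e \<epsilon>(1) \<epsilon>4 WA d Ed[OF A] \<eta>(1)] by blast
  obtain g' d2 where g': "\<And>x. 0 \<le> g' x" "\<And>x. g' x \<le> \<eta> * (d1 x)\<^sup>2" "\<And>x y. \<bar>g' y - g' x\<bar> \<le> 2 * dist y x"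
    and d2: "depth d2" "\<And>x. d2 x \<le> d1 x" "\<And>x. x \<in> A \<Longrightarrow> 0 < d2 x"
    and g'_slope: "\<And>z. 0 < d2 z \<Longrightarrow> lip_at (\<lambda>x. g' x - x \<bullet> e) (3 * \<epsilon>) z"
    using slope_function[OF e \<epsilon>(1) \<epsilon>4 WA d1(1) d1(3) \<eta>(1)] by blast
  obtain \<phi> where \<phi>: "\<And>x. \<bar>\<phi> x\<bar> \<le> 1" "\<And>x y. \<bar>\<phi> y - \<phi> x\<bar> \<le> 4 / r * dist y x"
    "\<And>x. dist c x \<le> 3 / 4 * r \<Longrightarrow> \<phi> x = 1" "\<And>x. x \<notin> cball c r \<Longrightarrow> \<phi> x = 0"
    using bump_function[OF r, of c] by blast
  define k where "k x = g x - g' x" for x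
  define h where "h x = \<phi> x * k x" for x
  have k_le: "\<bar>k x\<bar> \<le> \<eta> * (d x)\<^sup>2" for x
  proof -
    have "\<eta> * (d1 x)\<^sup>2 \<le> \<eta> * (d x)\<^sup>2"
      using d1(2)[of x] depthD(1)[OF d1(1), of x] \<eta>(1) by (intro mult_left_mono power_mono) auto
    thus ?thesis using g(1,2)[of x] g'(1,2)[of x] by (simp add: k_def)
  qed
  have k_le1: "\<bar>k x\<bar> \<le> \<eta>" for x
  proof -
    have "\<eta> * (d x)\<^sup>2 \<le> \<eta> * 1"
      using depthD(1,2)[OF d, of x] \<eta>(1) by (intro mult_left_mono power_le_one) auto
    thus ?thesis using k_le[of x] by simp
  qed
  have C\<eta>: "4 / r * \<eta> \<le> \<epsilon>" using \<eta>(3) r by (simp add: field_simps)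
  have lip_h: "lip_at h (L + \<epsilon>) z" if "lip_at k L z" "L \<ge> 0" for L z
  proof -
    have "lip_at h (L + 4 / r * \<eta>) z"
      unfolding h_def using that \<phi>(1,2) k_le1 r by (intro lip_at_mult) auto
    thus ?thesis using C\<eta> by (rule_tac lip_at_mono) auto
  qed
  have hle: "\<bar>h x\<bar> \<le> \<bar>k x\<bar>" for x
    using \<phi>(1)[of x] by (simp add: h_def abs_mult mult_left_le_one_le)
  \<comment> \<open>Outside the closed ball \<open>h\<close> vanishes and no slope has to be
    removed, so the complement may be kept; this retains the points of \<open>E\<close> outside
    \<open>A\<close>. The radius \<open>2 * r\<close> puts those in the closed ball into
    \<open>A\<close>.\<close>
  obtain d' where d': "depth d'" "\<And>x. d' x \<le> d x"
    "\<And>x. 0 < d' x \<longleftrightarrow> x \<in> - cball c r \<union> {x. 0 < d2 x} \<and> 0 < d x"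
  proof -
    have "open (- cball c r \<union> {x. 0 < d2 x})"
      by (intro open_Un open_depth_greater d2) auto
    thus ?thesis using that by (rule depth_of_open[OF _ d])
  qed
  show ?thesis
  proof (rule that[OF _ _ d'(1,2)])
    fix x
    show "\<bar>h x\<bar> \<le> \<kappa> * (d x)\<^sup>2"
      using hle[of x] k_le[of x] mult_right_mono[OF \<eta>(2), of "(d x)\<^sup>2"] by simp
    show "lip_at h 5 x"
    proof (rule lip_at_mono[OF lip_h])
      show "lip_at k (2 + 2) x"
        unfolding k_def using g(3) g'(3) by (intro lip_at_diff lip_at_of_lipschitz)
    qed (use \<epsilon> in auto)
    show "0 < d' x" if "x \<in> E"
      using that d2(3)[of x] Ed[of x] r by (auto simp: d'(3) A_def)
    show "lip_at h (20 * \<epsilon>) x" if "0 < d' x" "x \<in> cball c r"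
    proof (rule lip_at_mono[OF lip_h])
      have x: "0 < d2 x" using that d'(3) by auto
      hence "0 < d1 x" using d2(2)[of x] by simp
      from lip_at_diff[OF g_slope[OF this] g'_slope[OF x]]
      show "lip_at k (3 * \<epsilon> + 3 * \<epsilon>) x" by (simp add: k_def[abs_def])
    qed (use \<epsilon> in auto)
    show "lip_at h 0 x" if "x \<notin> cball c r"
    proof (rule lip_atI)
      have "open (- cball c r)" by auto
      hence "\<forall>\<^sub>F y in nhds x. y \<in> - cball c r" using that by (intro eventually_nhds_in_open) auto
      thus "\<forall>\<^sub>F y in nhds x. \<bar>h y - h x\<bar> \<le> 0 * dist y x"
        by eventually_elim (use that \<phi>(4) in \<open>simp add: h_def\<close>)
    qed
    assume xE: "x \<in> E" and xb: "x \<in> ball c (r / 2)"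
    have "x \<in> A" using xE xb r by (auto simp: A_def)
    hence x1: "0 < d1 x" "d1 x \<le> 1" using d1(3) depthD[OF d1(1)] by auto
    \<comment> \<open>A step proportional to \<open>d1 x\<close> stays where \<open>g\<close> has
      slope one, and the depth at most doubles along it; the quadratic bound then keeps
      \<open>g'\<close> small against \<open>t\<close>.\<close>
    define t where "t = \<tau> * d1 x"
    have t: "0 < t" "t \<le> \<tau>" "t \<le> d1 x / 2"
      using \<tau> x1 mult_right_mono[OF \<tau>(2), of "d1 x"] by (auto simp: t_def mult_left_le)
    define y where "y = x + t *\<^sub>R e"
    have dyx: "dist y x = t" using t e by (simp add: y_def dist_norm)
    have seg: "0 < d1 z" if "z \<in> closed_segment x y" for z
    proof -
      have "dist z x \<le> t" using segment_bound1[OF that] dyx by (simp add: dist_norm norm_minus_commute)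
      thus ?thesis using depthD(3)[OF d1(1), of z x] t x1 by linarith
    qed
    have "\<bar>(g y - y \<bullet> e) - (g x - x \<bullet> e)\<bar> \<le> 3 * \<epsilon> * dist x y"
      by (rule lip_at_segment) (use g_slope seg in blast)
    moreover have "y \<bullet> e - x \<bullet> e = t" using e by (simp add: y_def inner_add_left norm_eq_1)
    moreover have "3 * \<epsilon> * dist x y \<le> 3/16 * t" using \<epsilon> t dyx by (simp add: dist_commute)
    ultimately have "g y - g x \<ge> 13/16 * t" by linarith
    moreover have "g' y \<le> 1/8 * t"
    proof -
      have "d1 y \<le> 2 * d1 x" using depthD(3)[OF d1(1), of y x] dyx t by linarith
      hence "(d1 y)\<^sup>2 \<le> (2 * d1 x)\<^sup>2" using depthD(1)[OF d1(1)] by (intro power_mono) auto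
      also have "\<dots> \<le> 4 * d1 x" using x1 by (simp add: power2_eq_square mult_left_le)
      finally have "\<eta> * (d1 y)\<^sup>2 \<le> (\<tau> / 40) * (4 * d1 x)"
        using \<eta> \<tau> by (intro mult_mono) auto
      also have "\<dots> \<le> 1/8 * t" using t by (simp add: t_def)
      finally show ?thesis using g'(2)[of y] by simp
    qed
    ultimately have "k y - k x \<ge> t / 2" using g'(1)[of x] t by (simp add: k_def)
    moreover have cx: "dist c x < r / 2" using xb by simp
    have "\<phi> x = 1" using cx r by (intro \<phi>(3)) linarith
    moreover have "\<phi> y = 1"
      using cx r t \<tau> dist_triangle[of c y x] dyx dist_commute[of x y] by (intro \<phi>(3)) linarith
    ultimately have "dist y x / 2 \<le> \<bar>h y - h x\<bar>"
      using dyx abs_ge_self[of "k y - k x"] by (simp add: h_def)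
    moreover have "\<forall>z\<in>closed_segment x y. 0 < d z" using seg d1(2) by (meson less_le_trans)
    ultimately show "\<exists>y. 0 < dist y x \<and> dist y x \<le> \<kappa> \<and>
       (\<forall>z\<in>closed_segment x y. 0 < d z) \<and> dist y x / 2 \<le> \<bar>h y - h x\<bar>"
      using dyx t \<tau> by (intro exI[of _ y]) auto
  qed
qed

section \<open>The sum of the steps and its difference quotients\<close>

text \<open>The order of the steps is arbitrary, since each one works in the neighbourhood of
  \<open>E\<close> left by its predecessors. If the inner ball of step \<open>p\<close> contains
  \<open>x\<close>, the sum through \<open>p\<close> changes by at least 3/8 of the distance from
  \<open>x\<close> to some \<open>y\<close>, but by at most 1/8 of the distance on segments from
  \<open>x\<close> that stay where \<open>d (Suc p)\<close> is positive.\<close>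

lemma nondifferentiable_series:
  fixes E :: "(real ^ 'n) set" and V :: "nat set" and c e :: "nat \<Rightarrow> real ^ 'n" and r \<epsilon> :: "nat \<Rightarrow> real"
  assumes e: "\<And>p. p \<in> V \<Longrightarrow> norm (e p) = 1" and \<epsilon>: "\<And>p. p \<in> V \<Longrightarrow> 0 < \<epsilon> p"
    and W: "\<And>p. p \<in> V \<Longrightarrow> width (e p) (\<epsilon> p) (E \<inter> ball (c p) (2 * r p)) = 0"
    and r: "\<And>p. p \<in> V \<Longrightarrow> 0 < r p"
    and overlap: "\<And>z M. (\<Sum>p | p < M \<and> p \<in> V \<and> z \<in> cball (c p) (r p). \<epsilon> p) \<le> 1 / 160"
    and cover: "\<And>x. x \<in> E \<Longrightarrow> infinite {p \<in> V. x \<in> ball (c p) (r p / 2)}"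
  shows "\<exists>f :: real ^ 'n \<Rightarrow> real. (\<exists>L. L-lipschitz_on UNIV f) \<and> (\<forall>x\<in>E. \<not> f differentiable (at x))"
proof -
  have \<epsilon>16: "\<epsilon> p \<le> 1/160" if "p \<in> V" for p
  proof -
    have "(\<Sum>q\<in>{p}. \<epsilon> q) \<le> (\<Sum>q | q < Suc p \<and> q \<in> V \<and> c p \<in> cball (c q) (r q). \<epsilon> q)"
      using that r[OF that] by (intro sum_mono2) (auto intro: less_imp_le[OF \<epsilon>])
    thus ?thesis using overlap[of "Suc p" "c p"] by simp
  qed
  define Q where "Q d \<longleftrightarrow> depth d \<and> (\<forall>x\<in>E. 0 < d x)" for d :: "real ^ 'n \<Rightarrow> real"
  define R where "R p d h d' \<longleftrightarrow> (\<forall>x. \<bar>h x\<bar> \<le> (1/2) ^ p * (d x)\<^sup>2) \<and> (\<forall>z. lip_at h 5 z) \<and>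
    (\<forall>x. d' x \<le> d x) \<and>
    (\<forall>z. 0 < d' z \<longrightarrow> lip_at h (if p \<in> V \<and> z \<in> cball (c p) (r p) then 20 * \<epsilon> p else 0) z) \<and>
    (\<forall>x\<in>E. p \<in> V \<and> x \<in> ball (c p) (r p / 2) \<longrightarrow> (\<exists>y. 0 < dist y x \<and> dist y x \<le> (1/2) ^ p \<and>
       (\<forall>z\<in>closed_segment x y. 0 < d z) \<and> dist y x / 2 \<le> \<bar>h y - h x\<bar>))"
    for p d d' and h :: "real ^ 'n \<Rightarrow> real"
  have step: "\<exists>d'. Q d' \<and> (\<exists>h. R p d h d')" if "Q d" for p d
  proof (cases "p \<in> V")
    case True
    have d: "depth d" "\<And>x. x \<in> E \<Longrightarrow> 0 < d x" using that by (auto simp: Q_def)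
    have \<epsilon>': "\<epsilon> p \<le> 1/16" using \<epsilon>16[OF True] by simp
    have pow: "(1/2::real) ^ p > 0" by simp
    show ?thesis
    proof (rule toggle_step[OF e[OF True] \<epsilon>[OF True] \<epsilon>' W[OF True] r[OF True] d pow])
      fix h d'
      assume "\<And>x. \<bar>h x\<bar> \<le> (1/2) ^ p * (d x)\<^sup>2" "\<And>z. lip_at h 5 z"
        "depth d'" "\<And>x. d' x \<le> d x" "\<And>x. x \<in> E \<Longrightarrow> 0 < d' x"
        "\<And>z. 0 < d' z \<Longrightarrow> z \<in> cball (c p) (r p) \<Longrightarrow> lip_at h (20 * \<epsilon> p) z"
        "\<And>z. z \<notin> cball (c p) (r p) \<Longrightarrow> lip_at h 0 z"
        "\<And>x. x \<in> E \<Longrightarrow> x \<in> ball (c p) (r p / 2) \<Longrightarrow> \<exists>y. 0 < dist y x \<and> dist y x \<le> (1/2) ^ p \<and>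
           (\<forall>z\<in>closed_segment x y. 0 < d z) \<and> dist y x / 2 \<le> \<bar>h y - h x\<bar>"
      hence "Q d' \<and> R p d h d'" unfolding Q_def R_def using True by auto
      thus ?thesis by blast
    qed auto
  next
    case False
    have "R p d (\<lambda>x. 0) d"
      using False by (auto simp: R_def intro: lip_atI)
    thus ?thesis using that by blast
  qed
  have Q1: "Q (\<lambda>x. 1)" by (simp add: Q_def depth_def)
  obtain d where dQ: "\<And>p. Q (d p)" and dR: "\<And>p. \<exists>h. R p (d p) h (d (Suc p))"
    using dependent_nat_choice[of "\<lambda>_. Q" "\<lambda>p d d'. \<exists>h. R p d h d'"] Q1 step by metis
  obtain h where hR: "\<And>p. R p (d p) (h p) (d (Suc p))" using dR by metis
  have dep: "depth (d p)" for p using dQ[of p] by (simp add: Q_def)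
  have d0: "0 \<le> d p x" and d1: "d p x \<le> 1" for p x using depthD[OF dep] by auto
  have dE: "0 < d p x" if "x \<in> E" for p x using dQ[of p] that by (simp add: Q_def)
  have dSuc: "d (Suc p) x \<le> d p x" for p x using hR[of p] by (simp add: R_def)
  have dmono: "d q x \<le> d p x" if "p \<le> q" for p q x
    using that by (induction q rule: dec_induct) (use dSuc order_trans in blast)+
  have h_le: "\<bar>h p x\<bar> \<le> (1/2) ^ p * (d p x)\<^sup>2" for p x using hR[of p] by (simp add: R_def)
  have h5: "lip_at (h p) 5 z" for p z using hR[of p] by (simp add: R_def)
  define \<beta> where "\<beta> z p = (if p \<in> V \<and> z \<in> cball (c p) (r p) then 20 * \<epsilon> p else 0)" for z p
  have h_err: "lip_at (h p) (\<beta> z p) z" if "0 < d (Suc p) z" for p z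
    using hR[of p] that unfolding R_def \<beta>_def by blast
  \<comment> \<open>\<open>d p\<close> is 1-Lipschitz, so the quadratic bound makes
    \<open>h p\<close> vanish to second order here.\<close>
  have h_zero: "lip_at (h p) 0 z" if z: "d p z = 0" for p z
    unfolding lip_at_def
  proof (intro allI impI)
    fix L :: real assume L: "L > 0"
    have "\<forall>\<^sub>F y in nhds z. dist y z < L" using L by (auto simp: eventually_nhds_metric)
    thus "\<forall>\<^sub>F y in nhds z. \<bar>h p y - h p z\<bar> \<le> L * dist y z"
    proof eventually_elim
      case (elim y)
      have "h p z = 0" using h_le[of p z] z by simp
      moreover have "\<bar>h p y\<bar> \<le> L * dist y z"
      proof -
        have "(1/2::real) ^ p \<le> 1" by (rule power_le_one) auto
        hence "(1/2) ^ p * (d p y)\<^sup>2 \<le> 1 * (d p y)\<^sup>2" by (intro mult_right_mono) auto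
        also have "\<dots> \<le> 1 * (dist y z)\<^sup>2"
          using depthD(3)[OF dep, of p y z] z d0[of p y] by (intro mult_left_mono power_mono) auto
        also have "\<dots> \<le> L * dist y z"
          using elim by (auto simp: power2_eq_square intro!: mult_right_mono)
        finally show ?thesis using h_le[of p y] by simp
      qed
      ultimately show ?case by simp
    qed
  qed
  have \<beta>0: "0 \<le> \<beta> z p" for z p using less_imp_le[OF \<epsilon>] by (auto simp: \<beta>_def)
  \<comment> \<open>The bound 1/160 on the overlap is 1/8 divided by the factor 20 from
    \<open>toggle_step\<close>.\<close>
  have \<beta>sum: "(\<Sum>p<M. \<beta> z p) \<le> 1/8" for z M
  proof -
    have "(\<Sum>p<M. \<beta> z p) = (\<Sum>p | p < M \<and> p \<in> V \<and> z \<in> cball (c p) (r p). 20 * \<epsilon> p)"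
      unfolding \<beta>_def by (subst sum.inter_filter[symmetric]) (auto intro!: sum.cong)
    also have "\<dots> = 20 * (\<Sum>p | p < M \<and> p \<in> V \<and> z \<in> cball (c p) (r p). \<epsilon> p)"
      by (simp add: sum_distrib_left)
    finally show ?thesis using overlap[of M z] by simp
  qed
  have \<beta>1: "\<beta> z p \<le> 1/8" for z p
    using member_le_sum[of p "{..<Suc p}" "\<beta> z"] \<beta>0 \<beta>sum[of z "Suc p"] by simp
  define F where "F M x = (\<Sum>p<M. h p x)" for M x
  have F_err: "\<bar>F M y - F M x\<bar> \<le> 1/8 * dist x y" if "\<And>z. z \<in> closed_segment x y \<Longrightarrow> 0 < d M z" for M x y
  proof (rule lip_at_segment)
    fix z assume "z \<in> closed_segment x y"
    hence z: "0 < d M z" by (rule that)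
    have "lip_at (F M) (\<Sum>p<M. \<beta> z p) z" unfolding F_def
    proof (intro lip_at_sum h_err)
      fix p assume "p \<in> {..<M}"
      hence "d M z \<le> d (Suc p) z" by (intro dmono) auto
      thus "0 < d (Suc p) z" using z by simp
    qed
    thus "lip_at (F M) (1/8) z" using \<beta>sum by (rule lip_at_mono)
  qed
  \<comment> \<open>At a given point at most one summand, the last one that is active there, has a large slope.\<close>
  have F_lip: "6-lipschitz_on UNIV (F M)" for M
  proof (rule lip_at_lipschitz_on)
    fix z
    define \<nu> where "\<nu> p = (if 0 < d (Suc p) z then \<beta> z p else if 0 < d p z then 5 else 0)" for p
    have "lip_at (F M) (\<Sum>p<M. \<nu> p) z" unfolding F_def
    proof (rule lip_at_sum)
      fix p
      show "lip_at (h p) (\<nu> p) z"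
        using h_err[of p z] h5[of p z] h_zero[of p z] d0[of p z] by (auto simp: \<nu>_def less_le)
    qed
    moreover have "(\<Sum>p<M. \<nu> p) \<le> (\<Sum>p<M. \<beta> z p) + (if 0 < d M z then 0 else 5)"
    proof (induction M)
      case (Suc M)
      thus ?case using \<beta>0[of z M] dSuc[of M z] by (auto simp: \<nu>_def)
    qed simp
    ultimately show "lip_at (F M) 6 z"
      using \<beta>sum[of z M] by (rule_tac lip_at_mono) (auto split: if_splits)
  qed simp
  have h_pow: "norm (h p x) \<le> (1/2) ^ p" for p x
  proof -
    have "(1/2) ^ p * (d p x)\<^sup>2 \<le> (1/2) ^ p * 1"
      using d0[of p x] d1[of p x] by (intro mult_left_mono power_le_one) auto
    thus ?thesis using h_le[of p x] unfolding real_norm_def by linarith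
  qed
  have summ: "summable (\<lambda>p. h p x)" for x
    using h_pow by (intro summable_comparison_test'[OF summable_geometric[of "1/2"]]) auto
  define f where "f x = (\<Sum>p. h p x)" for x
  have F_lim: "(\<lambda>M. F M x) \<longlonglongrightarrow> f x" for x
    using summable_LIMSEQ[OF summ] by (simp add: F_def f_def)
  have "6-lipschitz_on UNIV f"
  proof (rule lipschitz_onI)
    fix x y
    have "(\<lambda>M. dist (F M x) (F M y)) \<longlonglongrightarrow> dist (f x) (f y)" by (intro tendsto_dist F_lim)
    thus "dist (f x) (f y) \<le> 6 * dist x y"
      by (rule LIMSEQ_le_const2) (use lipschitz_onD[OF F_lip] in auto)
  qed simp
  moreover have "\<not> f differentiable (at x)" if x: "x \<in> E" for x
  proof
    have tail: "\<bar>f y - F M y\<bar> \<le> 2 * (1/2) ^ M * (d M y)\<^sup>2" for M y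
    proof -
      have "f y - F M y = (\<Sum>p. h (p + M) y)"
        using suminf_minus_initial_segment[OF summ[of y], of M] by (simp add: f_def F_def)
      also have "norm \<dots> \<le> (\<Sum>p. (1/2) ^ p * ((1/2) ^ M * (d M y)\<^sup>2))"
      proof (rule norm_suminf_le)
        fix p
        have "(d (p + M) y)\<^sup>2 \<le> (d M y)\<^sup>2" using dmono[of M "p + M" y] d0 by (intro power_mono) auto
        hence "(1/2) ^ (p + M) * (d (p + M) y)\<^sup>2 \<le> (1/2) ^ (p + M) * (d M y)\<^sup>2"
          by (intro mult_left_mono) auto
        thus "norm (h (p + M) y) \<le> (1/2) ^ p * ((1/2) ^ M * (d M y)\<^sup>2)"
          using h_le[of "p + M" y] unfolding power_add mult.assoc real_norm_def by linarith
      qed (intro summable_mult2 summable_geometric, simp)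
      also have "\<dots> = 2 * (1/2) ^ M * (d M y)\<^sup>2"
        by (subst suminf_mult2[symmetric]) (auto simp: suminf_geometric summable_geometric)
      finally show ?thesis by simp
    qed
    assume "f differentiable (at x)"
    then obtain D where D: "(f has_derivative D) (at x)" by (auto simp: differentiable_def)
    have lin: "linear D" using D by (rule has_derivative_linear)
    \<comment> \<open>The tolerance 1/64 is spent three times at each distance: 24/64 - 3/64 is
      above 1/4, and 8/64 + 3/64 is below it.\<close>
    obtain s where s: "s > 0" "\<And>y. dist y x < s \<Longrightarrow> \<bar>f y - f x - D (y - x)\<bar> \<le> 1/64 * dist y x"
    proof -
      have "(1/64 :: real) > 0" by simp
      then obtain s where "s > 0"
        "\<forall>y. norm (y - x) < s \<longrightarrow> norm (f y - f x - D (y - x)) \<le> 1/64 * norm (y - x)"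
        using D unfolding has_derivative_at_alt by blast
      thus ?thesis using that by (simp add: dist_norm)
    qed
    obtain p0 where p0: "(1/2) ^ p0 < s" using real_arch_pow_inv[of s "1/2"] s by auto
    \<comment> \<open>\<open>p0\<close> brings \<open>y\<close> within the distance
      \<open>s\<close>; 8 gives \<open>a \<le> 1/256\<close>, which pays for the factor 4 between
      depth and distance in \<open>small\<close>.\<close>
    obtain p where p: "p \<ge> max p0 8" "p \<in> V" "x \<in> ball (c p) (r p / 2)"
      using cover[OF x] unfolding infinite_nat_iff_unbounded_le by blast
    define a where "a = (1/2::real) ^ p"
    have a: "0 < a" "a \<le> 1/256" "a < s"
    proof -
      have "(1/2::real) ^ p \<le> (1/2) ^ 8" using p by (intro power_decreasing) auto
      also have "\<dots> = 1/256" by (simp add: power_divide)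
      finally show "a \<le> 1/256" unfolding a_def .
      have "(1/2::real) ^ p \<le> (1/2) ^ p0" using p by (intro power_decreasing) auto
      also note p0
      finally show "a < s" unfolding a_def .
    qed (simp add: a_def)
    obtain y where y: "0 < dist y x" "dist y x \<le> a" "\<And>z. z \<in> closed_segment x y \<Longrightarrow> 0 < d p z"
      "dist y x / 2 \<le> \<bar>h p y - h p x\<bar>"
      using hR[of p] p x unfolding R_def a_def by blast
    define \<rho> where "\<rho> = dist y x"
    define t where "t = d (Suc p) x"
    have t: "0 < t" unfolding t_def using x by (rule dE)
    have near: "\<bar>d (Suc p) z - t\<bar> \<le> dist z x" for z
      unfolding t_def by (rule depthD(3)[OF dep])
    \<comment> \<open>Otherwise step \<open>p\<close> is switched off along the whole segment, and
      \<open>h p\<close> cannot change by half its length.\<close>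
    have t\<rho>: "t \<le> \<rho>"
    proof (rule ccontr)
      assume "\<not> t \<le> \<rho>"
      have "\<bar>h p y - h p x\<bar> \<le> 1/8 * dist x y"
      proof (rule lip_at_segment)
        fix z assume "z \<in> closed_segment x y"
        hence "dist z x \<le> \<rho>"
          using segment_bound1[of z x y] by (simp add: \<rho>_def dist_norm norm_minus_commute)
        hence "0 < d (Suc p) z" using near[of z] \<open>\<not> t \<le> \<rho>\<close> by linarith
        from lip_at_mono[OF h_err[OF this] \<beta>1] show "lip_at (h p) (1/8) z" .
      qed
      thus False using y(1,4) dist_commute[of x y] by linarith
    qed
    have tail': "\<bar>f z - F (Suc p) z\<bar> \<le> a * (d (Suc p) z)\<^sup>2" for z
      using tail[of z "Suc p"] by (simp add: a_def)
    have small: "a * w\<^sup>2 \<le> 1/64 * u" if "0 \<le> w" "w \<le> 4 * u" "w \<le> 1" for w u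
    proof -
      have "w\<^sup>2 \<le> w" using that by (simp add: power2_eq_square mult_left_le)
      hence "a * w\<^sup>2 \<le> 1/256 * w" using a that by (intro mult_mono) auto
      thus ?thesis using that by simp
    qed
    have tails: "\<bar>f z - F (Suc p) z\<bar> \<le> 1/64 * dist z x" if "t \<le> 2 * dist z x" for z
    proof -
      have "a * (d (Suc p) z)\<^sup>2 \<le> 1/64 * dist z x"
        using d0[of "Suc p" z] d1[of "Suc p" z] near[of z] that by (intro small) auto
      thus ?thesis using tail'[of z] by simp
    qed
    have tailx: "\<bar>f x - F (Suc p) x\<bar> \<le> 1/64 * u" if "t \<le> 2 * u" for u
    proof -
      have "a * (d (Suc p) x)\<^sup>2 \<le> 1/64 * u"
        using d1[of "Suc p" x] that t by (intro small) (auto simp: t_def)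
      thus ?thesis using tail'[of x] by simp
    qed
    have big: "\<bar>D (y - x)\<bar> \<ge> 1/4 * \<rho>"
    proof -
      have "\<bar>F p y - F p x\<bar> \<le> 1/8 * \<rho>"
        using F_err[OF y(3)] by (simp add: \<rho>_def dist_commute)
      moreover have "F (Suc p) z = F p z + h p z" for z by (simp add: F_def)
      hence "F (Suc p) y - F (Suc p) x = (F p y - F p x) + (h p y - h p x)" by simp
      ultimately have "\<bar>F (Suc p) y - F (Suc p) x\<bar> \<ge> 3/8 * \<rho>"
        using y(4) unfolding \<rho>_def[symmetric] by linarith
      moreover have "\<bar>f y - F (Suc p) y\<bar> \<le> 1/64 * \<rho>" "\<bar>f x - F (Suc p) x\<bar> \<le> 1/64 * \<rho>"
        using tails[of y] tailx[of \<rho>] t\<rho> t by (auto simp: \<rho>_def)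
      moreover have "\<bar>f y - f x - D (y - x)\<bar> \<le> 1/64 * \<rho>"
        using s(2)[of y] y a by (simp add: \<rho>_def)
      ultimately show ?thesis using y(1) unfolding \<rho>_def[symmetric] by linarith
    qed
    \<comment> \<open>The second test point lies on the ray from \<open>x\<close> through
      \<open>y\<close>, so that linearity applies, at half the depth of \<open>x\<close>, so that
      the segment to it stays where \<open>d (Suc p)\<close> is positive.\<close>
    define \<mu> where "\<mu> = t / (2 * \<rho>)"
    have \<rho>0: "0 < \<rho>" using y by (simp add: \<rho>_def)
    have \<mu>: "0 < \<mu>" "\<mu> * \<rho> = t / 2" using t \<rho>0 by (auto simp: \<mu>_def)
    define y' where "y' = x + \<mu> *\<^sub>R (y - x)"
    have dy': "dist y' x = t / 2" using \<mu> by (simp add: y'_def dist_norm \<rho>_def)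
    have "\<bar>F (Suc p) y' - F (Suc p) x\<bar> \<le> 1/8 * dist x y'"
    proof (rule F_err)
      fix z assume "z \<in> closed_segment x y'"
      hence "dist z x \<le> t / 2"
        using segment_bound1[of z x y'] dy' by (simp add: dist_norm norm_minus_commute)
      thus "0 < d (Suc p) z" using near[of z] t by linarith
    qed
    moreover have "\<bar>f y' - F (Suc p) y'\<bar> \<le> 1/64 * (t / 2)" "\<bar>f x - F (Suc p) x\<bar> \<le> 1/64 * (t / 2)"
      using tails[of y'] tailx[of "t / 2"] dy' by auto
    moreover have "\<bar>f y' - f x - D (y' - x)\<bar> \<le> 1/64 * (t / 2)"
      using s(2)[of y'] dy' t\<rho> y(2) a t by (simp add: \<rho>_def)
    ultimately have "\<bar>D (y' - x)\<bar> < 1/4 * (t / 2)"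
      using dy' t dist_commute[of x y'] by linarith
    moreover have "D (y' - x) = \<mu> * D (y - x)"
      using linear_cmul[OF lin, of \<mu> "y - x"] by (simp add: y'_def)
    hence "\<bar>D (y' - x)\<bar> = \<mu> * \<bar>D (y - x)\<bar>" using \<mu> by (simp add: abs_mult)
    moreover have "\<mu> * (1/4 * \<rho>) \<le> \<mu> * \<bar>D (y - x)\<bar>" using big \<mu> by (intro mult_left_mono) auto
    ultimately show False using \<mu>(2) by simp
  qed
  ultimately show ?thesis by blast
qed

subsection \<open>Whitney-type patches\<close>

lemma lattice_point_near:
  fixes x :: "real ^ 'n"
  assumes \<mu>: "\<mu> > 0"
  obtains f :: "'n \<Rightarrow> int" where "dist x (\<chi> i. \<mu> * of_int (f i)) \<le> real CARD('n) * \<mu>"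
proof
  let ?f = "\<lambda>i. \<lfloor>x $ i / \<mu>\<rfloor>"
  have "\<bar>(x - (\<chi> i. \<mu> * of_int (?f i))) $ i\<bar> \<le> \<mu>" for i
  proof -
    have "x $ i - \<mu> * of_int (?f i) = \<mu> * (x $ i / \<mu> - of_int (?f i))"
      using \<mu> by (simp add: right_diff_distrib)
    moreover have "\<bar>x $ i / \<mu> - of_int (?f i)\<bar> \<le> 1" by linarith
    ultimately show ?thesis using \<mu> by (simp add: abs_mult mult_left_le)
  qed
  hence "(\<Sum>i\<in>UNIV. \<bar>(x - (\<chi> i. \<mu> * of_int (?f i))) $ i\<bar>) \<le> (\<Sum>i\<in>(UNIV :: 'n set). \<mu>)"
    by (intro sum_mono) auto
  thus "dist x (\<chi> i. \<mu> * of_int (?f i)) \<le> real CARD('n) * \<mu>"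
    using norm_le_l1_cart[of "x - (\<chi> i. \<mu> * of_int (?f i))"] by (simp add: dist_norm)
qed

lemma lattice_points_card:
  fixes z :: "real ^ 'n" and m :: nat
  assumes \<mu>: "\<mu> > 0"
  defines "L \<equiv> {f :: 'n \<Rightarrow> int. dist z (\<chi> i. \<mu> * of_int (f i)) \<le> real m * \<mu>}"
  shows "finite L" "card L \<le> (2 * m + 2) ^ CARD('n)"
proof -
  define I where "I i = {\<lfloor>z $ i / \<mu>\<rfloor> - int m .. \<lfloor>z $ i / \<mu>\<rfloor> + 1 + int m}" for i
  have "f i \<in> I i" if "f \<in> L" for f i
  proof -
    have "\<bar>z $ i - \<mu> * of_int (f i)\<bar> \<le> real m * \<mu>"
      using component_le_norm_cart[of "z - (\<chi> i. \<mu> * of_int (f i))" i] that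
      by (simp add: L_def dist_norm)
    moreover have "z $ i - \<mu> * of_int (f i) = \<mu> * (z $ i / \<mu> - of_int (f i))"
      using \<mu> by (simp add: right_diff_distrib)
    ultimately have "\<mu> * \<bar>z $ i / \<mu> - of_int (f i)\<bar> \<le> \<mu> * real m"
      using \<mu> by (simp add: abs_mult mult.commute)
    hence "\<bar>z $ i / \<mu> - of_int (f i)\<bar> \<le> real m" using \<mu> by simp
    thus ?thesis unfolding I_def by (simp; linarith)
  qed
  hence sub: "L \<subseteq> PiE UNIV I" by auto
  have fin: "finite (PiE UNIV I)" by (intro finite_PiE) (auto simp: I_def)
  show "finite L" using sub fin by (rule finite_subset)
  have "card L \<le> card (PiE UNIV I)" using fin sub by (rule card_mono)
  also have "\<dots> = (\<Prod>i\<in>UNIV. card (I i))" by (rule card_PiE) simp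
  also have "\<dots> = (2 * m + 2) ^ CARD('n)"
    by (simp add: I_def nat_add_distrib nat_mult_distrib algebra_simps)
  finally show "card L \<le> (2 * m + 2) ^ CARD('n)" .
qed

text \<open>With this mesh, \<open>lattice_point_near\<close> finds a lattice point within a
  sixteenth of \<open>(1/2) ^ s\<close>.\<close>

definition lattice_point :: "nat \<Rightarrow> ('n \<Rightarrow> int) \<Rightarrow> real ^ 'n" where
  "lattice_point s f = (\<chi> i. (1/2) ^ s / (16 * real CARD('n)) * of_int (f i))"

text \<open>
  A Whitney-type family of balls for a hereditary property of balls: the size of a patch is
  comparable to the size of the largest ball around its centre that has the property, so that only
  boundedly many patches meet at a point.
\<close>

definition patches :: "(real ^ 'n \<Rightarrow> real \<Rightarrow> bool) \<Rightarrow> (nat \<times> ('n \<Rightarrow> int)) set" where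
  "patches P = {(s, f). P (lattice_point s f) ((1/2) ^ s / 2) \<and>
     (s = 0 \<or> \<not> P (lattice_point s f) (4 * (1/2) ^ s))}"

lemma ball_subset_ballI:
  fixes x y :: "'a::metric_space"
  assumes "dist y x + r \<le> r'" shows "ball y r \<subseteq> ball x r'"
proof
  fix w assume "w \<in> ball y r"
  thus "w \<in> ball x r'" using dist_triangle[of x w y] assms by (simp add: dist_commute)
qed

text \<open>Take the least \<open>s\<close> for which the ball of radius \<open>(1/2) ^ s\<close>
  around \<open>x\<close> has the property. If the ball of radius \<open>4 * (1/2) ^ s\<close>
  around a nearby lattice point had it, so would twice the radius around \<open>x\<close>, against
  minimality. For \<open>s = 0\<close> there is no larger scale to compare with.\<close>

lemma patches_cover:
  fixes P :: "real ^ 'n \<Rightarrow> real \<Rightarrow> bool"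
  assumes mono: "\<And>x y r r'. P x r \<Longrightarrow> ball y r' \<subseteq> ball x r \<Longrightarrow> P y r'"
    and P: "P x r" "r > 0"
  obtains s f where "(s, f) \<in> patches P" "x \<in> ball (lattice_point s f) ((1/2) ^ s / 8)"
proof -
  obtain j where "(1/2) ^ j < r" using real_arch_pow_inv[of r "1/2"] P by auto
  hence "P x ((1/2) ^ j)" using mono[OF P(1)] by (simp add: subset_ball)
  define s where "s = (LEAST s. P x ((1/2) ^ s))"
  have s: "P x ((1/2) ^ s)" unfolding s_def using \<open>P x ((1/2) ^ j)\<close> by (rule LeastI)
  define \<mu> where "\<mu> = (1/2) ^ s / (16 * real CARD('n))"
  have \<mu>: "\<mu> > 0" by (simp add: \<mu>_def)
  obtain f where f: "dist x (lattice_point s f) \<le> real CARD('n) * \<mu>"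
    using lattice_point_near[OF \<mu>, of x] unfolding lattice_point_def \<mu>_def by blast
  define h :: real where "h = (1/2) ^ s"
  have h: "h > 0" by (simp add: h_def)
  have near: "dist x (lattice_point s f) \<le> h / 16" using f by (simp add: \<mu>_def h_def)
  have "P (lattice_point s f) (h / 2)"
    using s near h unfolding h_def[symmetric]
    by (elim mono) (auto intro!: ball_subset_ballI simp: dist_commute)
  moreover have "s = 0 \<or> \<not> P (lattice_point s f) (4 * h)"
  proof (cases s)
    case (Suc s')
    have "\<not> P (lattice_point s f) (4 * h)"
    proof
      assume "P (lattice_point s f) (4 * h)"
      hence "P x (2 * h)" using near h by (elim mono) (auto intro!: ball_subset_ballI)
      hence "P x ((1/2) ^ s')" using Suc by (simp add: h_def)
      moreover have "s' < s" using Suc by simp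
      ultimately show False using not_less_Least unfolding s_def by blast
    qed
    thus ?thesis ..
  qed simp
  ultimately have "(s, f) \<in> patches P" by (simp add: patches_def h_def)
  moreover have "x \<in> ball (lattice_point s f) (h / 8)" using near h by (simp add: dist_commute)
  ultimately show ?thesis using that h_def by simp
qed

text \<open>Both conditions in \<open>patches\<close> transfer from the centre to \<open>z\<close>
  and leave only the scales from \<open>s0\<close> to \<open>s0 + 4\<close>. At each of them the
  centres lie within \<open>4 * CARD('n)\<close> meshes of \<open>z\<close>.\<close>

lemma patches_overlap:
  fixes P :: "real ^ 'n \<Rightarrow> real \<Rightarrow> bool" and z :: "real ^ 'n"
  assumes mono: "\<And>x y r r'. P x r \<Longrightarrow> ball y r' \<subseteq> ball x r \<Longrightarrow> P y r'"
  defines "T \<equiv> {(s, f) \<in> patches P. z \<in> cball (lattice_point s f) ((1/2) ^ s / 4)}"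
  shows "finite T" "card T \<le> 5 * (8 * CARD('n) + 2) ^ CARD('n)"
proof -
  define L where "L s = {f :: 'n \<Rightarrow> int. z \<in> cball (lattice_point s f) ((1/2) ^ s / 4)}" for s
  have L: "finite (L s)" "card (L s) \<le> (8 * CARD('n) + 2) ^ CARD('n)" for s
  proof -
    define \<mu> where "\<mu> = (1/2) ^ s / (16 * real CARD('n))"
    have \<mu>: "\<mu> > 0" by (simp add: \<mu>_def)
    have "L s = {f. dist z (\<chi> i. \<mu> * of_int (f i)) \<le> real (4 * CARD('n)) * \<mu>}"
      by (simp add: L_def lattice_point_def \<mu>_def dist_commute)
    thus "finite (L s)" "card (L s) \<le> (8 * CARD('n) + 2) ^ CARD('n)"
      using lattice_points_card[OF \<mu>, of z "4 * CARD('n)"] by (simp_all only:) simp_all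
  qed
  define s0 where "s0 = (LEAST s. P z ((1/2) ^ s / 4))"
  have "s0 \<le> s \<and> s < s0 + 5" if T: "(s, f) \<in> T" for s f
  proof -
    define h :: real where "h = (1/2) ^ s"
    have h: "h > 0" by (simp add: h_def)
    have near: "dist (lattice_point s f) z \<le> h / 4" using T by (simp add: T_def h_def)
    have "P (lattice_point s f) (h / 2)" using T by (simp add: T_def patches_def h_def)
    hence "P z (h / 4)" using near by (elim mono) (auto intro!: ball_subset_ballI simp: dist_commute)
    hence Pz: "P z ((1/2) ^ s / 4)" by (simp add: h_def)
    hence ge: "s0 \<le> s" unfolding s0_def by (rule Least_le)
    have s0: "P z ((1/2) ^ s0 / 4)" unfolding s0_def using Pz by (rule LeastI)
    have "s < s0 + 5"
    proof (rule ccontr)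
      assume "\<not> s < s0 + 5"
      hence s5: "s \<ge> s0 + 5" by simp
      hence "h \<le> (1/2) ^ (s0 + 5)" unfolding h_def by (intro power_decreasing) auto
      hence "8 * h \<le> (1/2) ^ s0 / 4" by (simp add: power_add power_divide)
      hence "P z (8 * h)" using s0 by (elim mono) (auto intro!: ball_subset_ballI)
      hence "P (lattice_point s f) (4 * h)"
        using near h by (elim mono) (auto intro!: ball_subset_ballI)
      thus False using T s5 by (simp add: T_def patches_def h_def)
    qed
    thus ?thesis using ge by simp
  qed
  hence sub: "T \<subseteq> (SIGMA s:{s0..<s0+5}. L s)" by (auto simp: T_def L_def)
  have fin: "finite (SIGMA s:{s0..<s0+5}. L s)" using L by auto
  show "finite T" using sub fin by (rule finite_subset)
  have "card T \<le> card (SIGMA s:{s0..<s0+5}. L s)" using fin sub by (rule card_mono)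
  also have "\<dots> = (\<Sum>s\<in>{s0..<s0+5}. card (L s))" using L by (subst card_SigmaI) auto
  also have "\<dots> \<le> (\<Sum>s\<in>{s0..<s0+5}. (8 * CARD('n) + 2) ^ CARD('n))" by (intro sum_mono L)
  finally show "card T \<le> 5 * (8 * CARD('n) + 2) ^ CARD('n)" by simp
qed

section \<open>Enumeration of the patches of all apertures\<close>

theorem theorem1p8:
  fixes E :: "(real ^ 'n) set"
  assumes "cone_unrectifiable E"
  shows "\<exists>f :: real ^ 'n \<Rightarrow> real.
           (\<exists>L. L-lipschitz_on UNIV f) \<and> (\<forall>x\<in>E. \<not> f differentiable (at x))"
proof -
  define K :: nat where "K = 5 * (8 * CARD('n) + 2) ^ CARD('n)"
  have K: "K > 0" by (simp add: K_def)
  \<comment> \<open>At most \<open>K\<close> patches of each family meet at a point, and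
    \<open>K\<close> times the sum of all \<open>a k\<close> is 1/160.\<close>
  define a :: "nat \<Rightarrow> real" where "a k = (1/2) ^ Suc k / (160 * real K)" for k
  have a: "a k > 0" for k using K by (simp add: a_def)
  define P where "P k x r \<longleftrightarrow> (\<exists>e. norm e = 1 \<and> width e (a k) (E \<inter> ball x r) = 0)"
    for k and x :: "real ^ 'n" and r
  have mono: "P k y r'" if x: "P k x r" and sub: "ball y r' \<subseteq> ball x r" for k x y r r'
  proof -
    obtain e where e: "norm e = 1" "width e (a k) (E \<inter> ball x r) = 0"
      using x unfolding P_def by blast
    have "width e (a k) (E \<inter> ball y r') \<le> width e (a k) (E \<inter> ball x r)"
      using sub by (intro width_subset) auto
    thus ?thesis using e by (auto simp: P_def)
  qed
  have P_E: "\<exists>r>0. P k x r" if "x \<in> E" for k x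
  proof -
    \<comment> \<open>Width in direction 0 is zero by convention, so a normal set other than
      \<open>{0}\<close> has a nonzero element.\<close>
    have "0 \<in> normal_set E x" by (auto simp: normal_set_def width_def intro: exI[of _ 1])
    moreover have "normal_set E x \<noteq> {0}" using assms that by (simp add: cone_unrectifiable_def)
    ultimately obtain e where e: "e \<in> normal_set E x" "e \<noteq> 0" by blast
    then obtain r where r: "r > 0" "width e (a k) (ball x r \<inter> E) = 0"
      using a by (auto simp: normal_set_def)
    have "width (inverse (norm e) *\<^sub>R e) (a k) (E \<inter> ball x r) = 0"
      using r(2) e(2) by (subst scaleR_width) (auto simp: Int_commute)
    moreover have "norm (inverse (norm e) *\<^sub>R e) = 1" using e(2) by simp
    ultimately show ?thesis using r(1) unfolding P_def by blast
  qed
  define dec :: "nat \<Rightarrow> nat \<times> nat \<times> ('n \<Rightarrow> int)" where "dec = from_nat"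
  define V where "V = {p. to_nat (dec p) = p \<and> snd (dec p) \<in> patches (P (fst (dec p)))}"
  define s where "s p = fst (snd (dec p))" for p
  define c where "c p = lattice_point (s p) (snd (snd (dec p)))" for p
  define r :: "nat \<Rightarrow> real" where "r p = (1/2) ^ s p / 4" for p
  define \<epsilon> where "\<epsilon> p = a (fst (dec p))" for p
  have "\<exists>e. norm e = 1 \<and> width e (\<epsilon> p) (E \<inter> ball (c p) (2 * r p)) = 0" if "p \<in> V" for p
    using that by (simp add: V_def patches_def case_prod_beta P_def \<epsilon>_def c_def r_def s_def)
  then obtain e where e: "\<And>p. p \<in> V \<Longrightarrow> norm (e p) = 1 \<and> width (e p) (\<epsilon> p) (E \<inter> ball (c p) (2 * r p)) = 0"
    by metis
  show ?thesis
  proof (rule nondifferentiable_series[where V = V and c = c and e = e and r = r and \<epsilon> = \<epsilon>])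
    show "norm (e p) = 1" "0 < \<epsilon> p" "width (e p) (\<epsilon> p) (E \<inter> ball (c p) (2 * r p)) = 0" "0 < r p"
      if "p \<in> V" for p
      using e[OF that] a by (auto simp: \<epsilon>_def r_def)
  next
    fix z :: "real ^ 'n" and M :: nat
    define S where "S = {p. p < M \<and> p \<in> V \<and> z \<in> cball (c p) (r p)}"
    define T where "T k = {(s, f) \<in> patches (P k). z \<in> cball (lattice_point s f) ((1/2) ^ s / 4)}" for k
    have T: "finite (T k)" "card (T k) \<le> K" for k
      unfolding T_def K_def by (rule patches_overlap, rule mono, assumption+)+
    have finS: "finite S" by (simp add: S_def)
    obtain B where B: "\<And>p. p \<in> S \<Longrightarrow> fst (dec p) < B"
      using finite_imageI[OF finS, of "\<lambda>p. fst (dec p)"] by (auto simp: finite_nat_set_iff_bounded)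
    have inj: "inj_on dec S"
      by (rule inj_on_inverseI[of _ to_nat]) (auto simp: S_def V_def)
    have sub: "dec ` S \<subseteq> (SIGMA k:{..<B}. T k)"
    proof
      fix w assume "w \<in> dec ` S"
      then obtain p where p: "p \<in> S" "w = dec p" by auto
      thus "w \<in> (SIGMA k:{..<B}. T k)"
        using B[OF p(1)] by (cases "dec p") (auto simp: S_def V_def T_def c_def r_def s_def)
    qed
    have "sum \<epsilon> S = (\<Sum>w\<in>dec ` S. a (fst w))" using inj by (simp add: sum.reindex \<epsilon>_def)
    also have "\<dots> \<le> (\<Sum>w\<in>(SIGMA k:{..<B}. T k). a (fst w))"
      using sub T by (intro sum_mono2) (auto intro: less_imp_le[OF a])
    also have "\<dots> = (\<Sum>k<B. real (card (T k)) * a k)"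
    proof -
      have "(\<Sum>k<B. \<Sum>q\<in>T k. a k) = (\<Sum>(k, q)\<in>(SIGMA k:{..<B}. T k). a k)"
        using T by (intro sum.Sigma) auto
      thus ?thesis by (simp add: split_def)
    qed
    also have "\<dots> \<le> (\<Sum>k<B. (1/2) ^ Suc k / 160)"
    proof (rule sum_mono)
      fix k
      have "real (card (T k)) * a k \<le> real K * a k"
        using T(2)[of k] a[of k] by (intro mult_right_mono) auto
      thus "real (card (T k)) * a k \<le> (1/2) ^ Suc k / 160" using K by (simp add: a_def)
    qed
    also have "\<dots> = (\<Sum>k<B. (1/2) ^ Suc k) / 160" by (simp add: sum_divide_distrib)
    also have "\<dots> \<le> 1 / 160"
    proof -
      have "(\<Sum>k<B. (1/2::real) ^ Suc k) = 1 - (1/2) ^ B" by (induction B) auto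
      thus ?thesis by simp
    qed
    finally show "(\<Sum>p | p < M \<and> p \<in> V \<and> z \<in> cball (c p) (r p). \<epsilon> p) \<le> 1 / 160"
      by (simp add: S_def)
  next
    fix x assume x: "x \<in> E"
    \<comment> \<open>The family of every aperture covers \<open>E\<close>, and patches of different
      families have different codes.\<close>
    have "\<exists>p. p \<in> V \<and> x \<in> ball (c p) (r p / 2) \<and> fst (dec p) = k" for k
    proof -
      obtain r0 where r0: "r0 > 0" "P k x r0" using P_E[OF x] by blast
      obtain s' f where sf: "(s', f) \<in> patches (P k)" "x \<in> ball (lattice_point s' f) ((1/2) ^ s' / 8)"
        by (rule patches_cover[where P = "P k", OF mono r0(2,1)])
      have "dec (to_nat (k, s', f)) = (k, s', f)" by (simp add: dec_def)
      thus ?thesis using sf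
        by (intro exI[of _ "to_nat (k, s', f)"]) (simp add: V_def c_def r_def s_def)
    qed
    then obtain p where p: "\<And>k. p k \<in> V \<and> x \<in> ball (c (p k)) (r (p k) / 2) \<and> fst (dec (p k)) = k"
      by metis
    have "inj p" by (rule inj_on_inverseI[of _ "\<lambda>q. fst (dec q)"]) (use p in auto)
    hence "infinite (range p)" by (simp add: finite_image_iff)
    moreover have "range p \<subseteq> {q \<in> V. x \<in> ball (c q) (r q / 2)}" using p by blast
    ultimately show "infinite {q \<in> V. x \<in> ball (c q) (r q / 2)}" using finite_subset by blast
  qed
qed

end
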